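(* Let $\{A_d\}$ be the (average) weight spectrum of a specific binary linear block code of length $n$ or of an ensemble of binary linear block codes of length $n$, used with BPSK over an AWGN channel with noise variance $\sigma^2>0$ per component. The word-error probability under maximum-likelihood decoding can be upper-bounded by $$\Pr\{E\}\le\min_{0\le d^*\le n}\Big\{\sum_{d\le 2d^*}h(A_d)+B(p_b,n,d^*+1,n)\Big\},$$ where $d$ runs over the nonzero weights $1\le d\le n$ with $d\le 2d^*$, and (for given $d^*$) $$h(A_d)=\min\Big\{A_d\,Q(\sqrt d/\sigma)\,B(p_b,n-d,0,d^*-1),\ \ (A_d-1)\Big(Q(\sqrt d/\sigma)-\tfrac12Q^2(\sqrt d/\sigma)\Big)B(p_b,n-2d,0,d^*-1)+Q(\sqrt d/\sigma)\Big\}.$$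
   Context: Channel and decoder: a binary linear code $\mathcal C\subseteq\mathbb F_2^n$ is used with the BPSK map $\phi:\mathbb F_2^n\to\{-1,+1\}^n$, $\phi(\underline v)_t=1-2v_t$. The all-zero codeword $\underline c^{(0)}$ is transmitted (by symmetry the error probability does not depend on the transmitted codeword); the received vector is $\underline y=\phi(\underline c^{(0)})+\underline z$, with $\underline z$ having i.i.d. $\mathcal N(0,\sigma^2)$ components. Maximum-likelihood decoding outputs the codeword whose image under $\phi$ is nearest to $\underline y$ in Euclidean distance; $E$ is the event that the output differs from $\underline c^{(0)}$. Weight spectrum: for a code $\mathcal C$, $A_d^{\mathcal C}$ is the number of codewords of Hamming weight $d$. A code ensemble $\mathscr C$ is a collection of binary linear codes of length $n$ with a probability distribution $\Pr\{\mathcal C\}$, $\mathcal C\in\mathscr C$; its average weight spectrum is $A_d=\sum_{\mathcal C}\Pr\{\mathcal C\}A_d^{\mathcal C}$, and for an ensemble $\Pr\{E\}=\sum_{\mathcal C}\Pr\{\mathcal C\}\Pr\{E\mid\mathcal C\}$. A specific code is the special case of an ensemble with one member. Notation: $Q(x)=\int_x^{\infty}\frac1{\sqrt{2\pi}}e^{-z^2/2}\,dz$; $p_b=Q(1/\sigma)$; $B(p,N_t,N_\ell,N_u)=\sum_{m=N_\ell}^{N_u}\binom{N_t}{m}p^m(1-p)^{N_t-m}$, i.e. the probability that the number of bit errors in a binary vector of total length $N_t$, passed through a binary symmetric channel with crossover probability $p$, ranges from $N_\ell$ to $N_u$ (an empty sum is $0$). *)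

theory Defs
  imports "HOL-Probability.Probability" "HOL-Library.Z2"
begin

type_synonym 'n word = "bit ^ 'n"

type_synonym 'n code = "'n word set"

definition bpsk :: "'n::finite word \<Rightarrow> real ^ 'n" where
  "bpsk v = (\<chi> t. 1 - 2 * of_bit (v $ t))"

definition hamming_weight :: "'n::finite word \<Rightarrow> nat" where
  "hamming_weight v = card {t. v $ t \<noteq> 0}"

definition weight_spectrum :: "'n::finite code \<Rightarrow> nat \<Rightarrow> nat" where
  "weight_spectrum C d = card {c \<in> C. hamming_weight c = d}"

definition linear_code :: "'n::finite code \<Rightarrow> bool" where
  "linear_code C \<longleftrightarrow> vec.subspace C"

definition awgn :: "real \<Rightarrow> (real ^ 'n::finite) measure" where
  "awgn \<sigma> = distr (\<Pi>\<^sub>M t\<in>(UNIV :: 'n set). density lborel (normal_density 0 \<sigma>)) borel (\<lambda>z. \<chi> t. z t)"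

text \<open>
  A decoder is a measurable map, so that its error event has a probability.
  Ties (a null event) may be broken arbitrarily.
\<close>

definition ml_decoder :: "'n::finite code \<Rightarrow> (real ^ 'n \<Rightarrow> 'n word) \<Rightarrow> bool" where
  "ml_decoder C \<delta> \<longleftrightarrow>
     \<delta> \<in> measurable borel (count_space UNIV) \<and>
     (\<forall>y. is_arg_min (\<lambda>c. dist y (bpsk c)) (\<lambda>c. c \<in> C) (\<delta> y))"

text \<open>The word-error probability is taken conditionally on transmission of the zero codeword.\<close>

definition word_error_prob :: "real \<Rightarrow> (real ^ 'n::finite \<Rightarrow> 'n word) \<Rightarrow> real" where
  "word_error_prob \<sigma> \<delta> = measure (awgn \<sigma>) {z. \<delta> (bpsk 0 + z) \<noteq> 0}"

text \<open>
  An ensemble is a probability mass function on codes; a specific code \<open>C\<close> is \<open>return_pmf C\<close>.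
  There are only finitely many codes of a given length, so the expectations below are finite sums.
\<close>

definition avg_weight_spectrum :: "'n::finite code pmf \<Rightarrow> nat \<Rightarrow> real" where
  "avg_weight_spectrum p d = measure_pmf.expectation p (\<lambda>C. real (weight_spectrum C d))"

definition ensemble_error_prob ::
    "real \<Rightarrow> 'n::finite code pmf \<Rightarrow> ('n code \<Rightarrow> real ^ 'n \<Rightarrow> 'n word) \<Rightarrow> real" where
  "ensemble_error_prob \<sigma> p \<delta> = measure_pmf.expectation p (\<lambda>C. word_error_prob \<sigma> (\<delta> C))"

definition Q :: "real \<Rightarrow> real" where
  "Q x = (LBINT z:{x..}. std_normal_density z)"

definition B :: "real \<Rightarrow> nat \<Rightarrow> nat \<Rightarrow> nat \<Rightarrow> real" where
  "B p Nt Nl Nu = (\<Sum>m=Nl..Nu. real (Nt choose m) * p ^ m * (1 - p) ^ (Nt - m))"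

text \<open>
  Subtraction is truncated. \<open>n - 2 * d\<close> is the length of a vector and is \<open>0\<close> when \<open>2 * d > n\<close>;
  the factor is then the probability of at most \<open>ds - 1\<close> errors in the empty vector, namely \<open>1\<close>.
  The bound only involves \<open>1 \<le> d\<close>, \<open>d \<le> n\<close> and \<open>d \<le> 2 * ds\<close>, so \<open>n - d\<close> and \<open>ds - 1\<close> are
  proper differences there.
\<close>

definition h :: "real \<Rightarrow> nat \<Rightarrow> nat \<Rightarrow> nat \<Rightarrow> real \<Rightarrow> real" where
  "h \<sigma> n ds d a =
     (let p = Q (1 / \<sigma>); q = Q (sqrt (real d) / \<sigma>) in
      min (a * q * B p (n - d) 0 (ds - 1))
          ((a - 1) * (q - 1 / 2 * q\<^sup>2) * B p (n - 2 * d) 0 (ds - 1) + q))"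

end

theory Submission
  imports Defs
begin

text \<open>
  Flipping signs by a codeword \<open>c\<close> is a symmetry of the decision regions that exchanges the
  likelihoods of \<open>0\<close> and \<open>c\<close>, so maximum-likelihood decoding errs no more often than a list decoder
  that only looks at codewords within Hamming distance \<open>d*\<close> of the hard decision. If the hard
  decision has at most \<open>d*\<close> errors, that decoder can only be misled by a codeword \<open>c\<close> of weight
  \<open>d \<le> 2 d*\<close> with \<open>\<Sum>t\<in>supp c. y t \<le> 0\<close>. This forces an error inside the support of \<open>c\<close>, hence at most
  \<open>d* - 1\<close> errors outside it, independently. The union bound gives the first term of \<open>h\<close>. For the
  second, fix one codeword \<open>c1\<close> of weight \<open>d\<close> and bound, for every other \<open>c\<close>, the event
  \<open>E\<^sub>c - E\<^sub>c\<^sub>1\<close>, where \<open>E\<^sub>c\<close> is the event that \<open>c\<close> is nearer than \<open>0\<close>. These events are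
  positively correlated, so its probability is at most \<open>Q - Q\<^sup>2\<close>.
\<close>

section \<open>Product measures and Gaussian tails\<close>

text \<open>Product measures are determined by boxes, and the preimage of a box under a
  coordinatewise map is a box. Sigma-finiteness in place of probability lets this cover sign flips
  of Lebesgue measure as well as the shift of the noise.\<close>

lemma distr_PiM_coordinatewise:
  assumes I: "finite I"
    and M: "\<And>i. sigma_finite_measure (M i)" and N: "\<And>i. sigma_finite_measure (N i)"
    and f: "\<And>i. i \<in> I \<Longrightarrow> f i \<in> measurable (M i) (N i)"
    and d: "\<And>i. i \<in> I \<Longrightarrow> distr (M i) (N i) (f i) = N i"
  shows "distr (PiM I M) (PiM I N) (\<lambda>x. \<lambda>i\<in>I. f i (x i)) = PiM I N"
proof -
  interpret N: product_sigma_finite N using N by (simp add: product_sigma_finite_def)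
  interpret M: product_sigma_finite M using M by (simp add: product_sigma_finite_def)
  have meas: "(\<lambda>x. \<lambda>i\<in>I. f i (x i)) \<in> measurable (PiM I M) (PiM I N)"
    using f by (auto intro!: measurable_restrict measurable_compose[OF measurable_component_singleton])
  show ?thesis
  proof (rule N.PiM_eqI[OF I])
    show "sets (distr (PiM I M) (PiM I N) (\<lambda>x. \<lambda>i\<in>I. f i (x i))) = sets (PiM I N)" by simp
    fix A assume A: "\<And>i. i \<in> I \<Longrightarrow> A i \<in> sets (N i)"
    have "(\<lambda>x. \<lambda>i\<in>I. f i (x i)) -` Pi\<^sub>E I A \<inter> space (PiM I M)
        = Pi\<^sub>E I (\<lambda>i. f i -` A i \<inter> space (M i))"
      by (auto simp: space_PiM PiE_iff extensional_def)
    moreover have "Pi\<^sub>E I A \<in> sets (PiM I N)"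
      using A I by (intro sets_PiM_I_finite) auto
    ultimately have "emeasure (distr (PiM I M) (PiM I N) (\<lambda>x. \<lambda>i\<in>I. f i (x i))) (Pi\<^sub>E I A)
        = emeasure (PiM I M) (Pi\<^sub>E I (\<lambda>i. f i -` A i \<inter> space (M i)))"
      using meas by (simp add: emeasure_distr)
    also have "\<dots> = (\<Prod>i\<in>I. emeasure (M i) (f i -` A i \<inter> space (M i)))"
      using I A f by (intro M.emeasure_PiM) (auto intro: measurable_sets)
    also have "\<dots> = (\<Prod>i\<in>I. emeasure (N i) (A i))"
    proof (rule prod.cong[OF refl])
      fix i assume i: "i \<in> I"
      have "emeasure (M i) (f i -` A i \<inter> space (M i)) = emeasure (distr (M i) (N i) (f i)) (A i)"
        using f[OF i] A[OF i] by (simp add: emeasure_distr)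
      then show "emeasure (M i) (f i -` A i \<inter> space (M i)) = emeasure (N i) (A i)"
        using d[OF i] by simp
    qed
    finally show "emeasure (distr (PiM I M) (PiM I N) (\<lambda>x. \<lambda>i\<in>I. f i (x i))) (Pi\<^sub>E I A)
        = (\<Prod>i\<in>I. emeasure (N i) (A i))" .
  qed
qed

text \<open>The indicator of a box is a product of indicators, so the integral of a product density
  over it factors. This gives the received vector a density with respect to a product of Lebesgue
  measures, where likelihoods can be compared pointwise.\<close>

lemma density_PiM:
  assumes I: "finite I"
    and M: "\<And>i. sigma_finite_measure (M i)"
    and MD: "\<And>i. sigma_finite_measure (density (M i) (f i))"
    and f: "\<And>i. i \<in> I \<Longrightarrow> f i \<in> borel_measurable (M i)"
  shows "PiM I (\<lambda>i. density (M i) (f i)) = density (PiM I M) (\<lambda>x. \<Prod>i\<in>I. f i (x i))"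
proof -
  interpret N: product_sigma_finite "\<lambda>i. density (M i) (f i)"
    using MD by (simp add: product_sigma_finite_def)
  interpret M: product_sigma_finite M using M by (simp add: product_sigma_finite_def)
  have meas: "(\<lambda>x. \<Prod>i\<in>I. f i (x i)) \<in> borel_measurable (PiM I M)"
    using f by (auto intro!: borel_measurable_prod_ennreal measurable_compose[OF measurable_component_singleton])
  show ?thesis
  proof (rule N.PiM_eqI[OF I, symmetric])
    show "sets (density (PiM I M) (\<lambda>x. \<Prod>i\<in>I. f i (x i))) = sets (PiM I (\<lambda>i. density (M i) (f i)))"
      by (auto intro!: sets_PiM_cong)
    fix A assume "\<And>i. i \<in> I \<Longrightarrow> A i \<in> sets (density (M i) (f i))"
    then have A: "\<And>i. i \<in> I \<Longrightarrow> A i \<in> sets (M i)" by simp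
    have "emeasure (density (PiM I M) (\<lambda>x. \<Prod>i\<in>I. f i (x i))) (Pi\<^sub>E I A)
        = (\<integral>\<^sup>+x. (\<Prod>i\<in>I. f i (x i)) * indicator (Pi\<^sub>E I A) x \<partial>PiM I M)"
      using meas A I by (intro emeasure_density) auto
    also have "\<dots> = (\<integral>\<^sup>+x. (\<Prod>i\<in>I. f i (x i) * indicator (A i) (x i)) \<partial>PiM I M)"
    proof (rule nn_integral_cong)
      fix x assume x: "x \<in> space (PiM I M)"
      have "indicator (Pi\<^sub>E I A) x = (\<Prod>i\<in>I. indicator (A i) (x i) :: ennreal)"
        using x I by (auto simp: indicator_def PiE_iff space_PiM prod_zero_iff split: if_splits)
      then show "(\<Prod>i\<in>I. f i (x i)) * indicator (Pi\<^sub>E I A) x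
          = (\<Prod>i\<in>I. f i (x i) * indicator (A i) (x i))"
        by (simp add: prod.distrib)
    qed
    also have "\<dots> = (\<Prod>i\<in>I. \<integral>\<^sup>+x. f i x * indicator (A i) x \<partial>M i)"
      using I f A by (intro M.product_nn_integral_prod) auto
    also have "\<dots> = (\<Prod>i\<in>I. emeasure (density (M i) (f i)) (A i))"
      using f A by (intro prod.cong refl) (simp add: emeasure_density)
    finally show "emeasure (density (PiM I M) (\<lambda>x. \<Prod>i\<in>I. f i (x i))) (Pi\<^sub>E I A)
        = (\<Prod>i\<in>I. emeasure (density (M i) (f i)) (A i))" .
  qed
qed

section \<open>Gaussian tails and joint laws\<close>

lemma Q_eq_measure: "Q x = measure (density lborel std_normal_density) {x..}"
proof -
  have "Q x = (\<integral>z. indicator {x..} z * std_normal_density z \<partial>lborel)"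
    by (simp add: Q_def set_lebesgue_integral_def)
  also have "\<dots> = (\<integral>z. indicator {x..} z \<partial>density lborel std_normal_density)"
    by (subst integral_density) (auto simp: normal_density_nonneg mult.commute)
  finally show ?thesis by simp
qed

lemma Q_nonneg: "0 \<le> Q x"
  by (simp add: Q_eq_measure)

lemma Q_le_1: "Q x \<le> 1"
  using prob_space.prob_le_1[OF prob_space_normal_density[of 1 0], of "{x..}"]
  by (simp add: Q_eq_measure)

text \<open>The reflected standardisation \<open>(m - X) / s\<close> is standard normal and turns
  the lower tail of \<open>X\<close> at 0 into the upper tail at \<open>m / s\<close>.\<close>

lemma (in prob_space) prob_normal_nonpos:
  assumes X: "distributed M lborel X (normal_density m s)" and s: "0 < s"
  shows "prob {x \<in> space M. X x \<le> 0} = Q (m / s)"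
proof -
  have "distributed M lborel (\<lambda>x. m / s + (- 1 / s) * X x)
      (normal_density (m / s + (- 1 / s) * m) (\<bar>- 1 / s\<bar> * s))"
    using X s by (intro normal_density_affine) auto
  then have D: "distributed M lborel (\<lambda>x. m / s + (- 1 / s) * X x) std_normal_density"
    using s by simp
  have "Q (m / s) = measure (distr M lborel (\<lambda>x. m / s + (- 1 / s) * X x)) {m / s..}"
    using distributed_distr_eq_density[OF D] by (simp add: Q_eq_measure)
  also have "\<dots> = prob ((\<lambda>x. m / s + (- 1 / s) * X x) -` {m / s..} \<inter> space M)"
    using distributed_measurable[OF D] by (intro measure_distr) auto
  also have "(\<lambda>x. m / s + (- 1 / s) * X x) -` {m / s..} \<inter> space M = {x \<in> space M. X x \<le> 0}"
    using s by (auto simp: divide_le_0_iff)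
  finally show ?thesis by simp
qed

text \<open>A law with a Lebesgue density has no atoms. This is what makes decoding ties
  negligible.\<close>

lemma (in prob_space) prob_distributed_lborel_eq:
  fixes X :: "'a \<Rightarrow> real"
  assumes X: "distributed M lborel X f"
  shows "prob {x \<in> space M. X x = a} = 0"
proof -
  have f: "f \<in> borel_measurable lborel"
    using distributed_borel_measurable[OF X] by simp
  have "emeasure M {x \<in> space M. X x = a} = emeasure (distr M lborel X) {a}"
    using distributed_measurable[OF X] by (subst emeasure_distr) (auto intro!: arg_cong[where f="emeasure M"])
  also have "\<dots> = (\<integral>\<^sup>+x. f x * indicator {a} x \<partial>lborel)"
    using distributed_distr_eq_density[OF X] f by (simp add: emeasure_density)
  also have "\<dots> = 0"
    using AE_lborel_singleton[of a] f
    by (subst nn_integral_0_iff_AE) (auto elim!: eventually_mono simp: indicator_def)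
  finally show ?thesis by (simp add: measure_def)
qed

text \<open>Stated as a product law because \<open>f\<close> and \<open>g\<close> may have different
  value types: in the application one gives a real and the other a pair of reals.\<close>

lemma (in prob_space) distr_Pair_compose_indep_var:
  assumes ind: "indep_var S X T Y"
    and f: "f \<in> measurable S S'" and g: "g \<in> measurable T T'"
  shows "distr M (S' \<Otimes>\<^sub>M T') (\<lambda>x. (f (X x), g (Y x)))
    = distr M S' (\<lambda>x. f (X x)) \<Otimes>\<^sub>M distr M T' (\<lambda>x. g (Y x))"
proof -
  have X[measurable]: "X \<in> measurable M S" and Y[measurable]: "Y \<in> measurable M T"
    using ind by (auto dest: indep_var_rv1 indep_var_rv2)
  note f[measurable] g[measurable]
  interpret g: prob_space "distr (distr M T Y) T' g"
    using g by (intro prob_space.prob_space_distr prob_space_distr) auto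
  have "distr M S' (\<lambda>x. f (X x)) \<Otimes>\<^sub>M distr M T' (\<lambda>x. g (Y x))
      = distr (distr M S X) S' f \<Otimes>\<^sub>M distr (distr M T Y) T' g"
    by (simp add: distr_distr comp_def)
  also have "\<dots> = distr (distr M S X \<Otimes>\<^sub>M distr M T Y) (S' \<Otimes>\<^sub>M T') (\<lambda>(x, y). (f x, g y))"
    by (intro pair_measure_distr) (auto intro: g.sigma_finite_measure_axioms)
  also have "\<dots> = distr M (S' \<Otimes>\<^sub>M T') (\<lambda>x. (f (X x), g (Y x)))"
    using ind by (simp add: indep_var_distribution_eq distr_distr comp_def)
  finally show ?thesis by simp
qed

text \<open>Given \<open>U\<close> the two events are independent with equal probability, so Jensen applies.\<close>

lemma (in prob_space) power2_prob_le_prob_common_summand: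
  fixes U V V' :: "'a \<Rightarrow> real"
  assumes [measurable]: "U \<in> borel_measurable M" "V \<in> borel_measurable M" "V' \<in> borel_measurable M"
    and UV: "distr M (borel \<Otimes>\<^sub>M borel \<Otimes>\<^sub>M borel) (\<lambda>x. (U x, V x, V' x))
      = distr M borel U \<Otimes>\<^sub>M distr M (borel \<Otimes>\<^sub>M borel) (\<lambda>x. (V x, V' x))"
    and VV: "indep_var borel V borel V'"
    and eq: "distr M borel V' = distr M borel V"
  shows "(prob {x \<in> space M. U x + V x \<le> 0})\<^sup>2
    \<le> prob {x \<in> space M. U x + V x \<le> 0 \<and> U x + V' x \<le> 0}"
proof -
  define D where "D = distr M borel V"
  define DU where "DU = distr M borel U"
  interpret D: prob_space D unfolding D_def by (rule prob_space_distr) simp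
  interpret DU: prob_space DU unfolding DU_def by (rule prob_space_distr) simp
  interpret DD: pair_prob_space D D ..
  have [simp, measurable_cong]: "sets D = sets borel" "sets DU = sets borel"
    by (auto simp: D_def DU_def)
  have [simp]: "space D = UNIV" "space DU = UNIV" by (auto simp: D_def DU_def)
  let ?E1 = "{z :: real \<times> real. fst z + snd z \<le> 0}"
  have E1[measurable]: "?E1 \<in> sets (borel \<Otimes>\<^sub>M borel)"
  proof -
    have "{z \<in> space (borel \<Otimes>\<^sub>M borel). fst z + snd z \<le> (0::real)} \<in> sets (borel \<Otimes>\<^sub>M borel)"
      by measurable
    then show ?thesis by (simp add: space_pair_measure)
  qed
  \<comment> \<open>\<open>F u\<close> is the conditional probability of
    \<open>U + V \<le> 0\<close> given \<open>U = u\<close>, and equally that of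
    \<open>U + V' \<le> 0\<close>.\<close>
  define F where "F u = measure D {v. u + v \<le> 0}" for u
  have Fm[measurable]: "F \<in> borel_measurable borel"
  proof -
    have "?E1 \<in> sets (borel \<Otimes>\<^sub>M D)"
      using E1 by (simp cong: sets_pair_measure_cong)
    from D.measurable_emeasure_Pair[OF this]
    have "(\<lambda>u. enn2real (emeasure D {v. u + v \<le> 0})) \<in> borel_measurable borel"
      by (simp add: vimage_def)
    then show ?thesis by (simp add: F_def[abs_def] measure_def)
  qed
  have F01: "0 \<le> F u" "F u \<le> 1" for u by (auto simp: F_def)
  have UVd: "distr M (borel \<Otimes>\<^sub>M borel \<Otimes>\<^sub>M borel) (\<lambda>x. (U x, V x, V' x)) = DU \<Otimes>\<^sub>M (D \<Otimes>\<^sub>M D)"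
    using UV VV[unfolded indep_var_distribution_eq] eq by (simp add: D_def DU_def)
  \<comment> \<open>The law of \<open>(U, V)\<close> is obtained from the joint law of all three by
    projecting \<open>V'\<close> away.\<close>
  have Ud: "distr M (borel \<Otimes>\<^sub>M borel) (\<lambda>x. (U x, V x)) = DU \<Otimes>\<^sub>M D"
  proof -
    have "distr M (borel \<Otimes>\<^sub>M borel) (\<lambda>x. (U x, V x))
        = distr (distr M (borel \<Otimes>\<^sub>M borel \<Otimes>\<^sub>M borel) (\<lambda>x. (U x, V x, V' x))) (borel \<Otimes>\<^sub>M borel)
            (\<lambda>z. (fst z, fst (snd z)))"
      by (subst distr_distr) (auto simp: comp_def)
    also have "\<dots> = distr (DU \<Otimes>\<^sub>M (D \<Otimes>\<^sub>M D)) (borel \<Otimes>\<^sub>M borel) (\<lambda>(u, v). (id u, fst v))"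
      by (simp add: UVd case_prod_unfold)
    also have "\<dots> = distr DU borel id \<Otimes>\<^sub>M distr (D \<Otimes>\<^sub>M D) borel fst"
      by (intro pair_measure_distr[symmetric] prob_space_imp_sigma_finite DD.prob_space_distr) auto
    also have "distr (D \<Otimes>\<^sub>M D) borel fst = D"
      using D.distr_pair_fst[of D] by (simp cong: distr_cong)
    also have "distr DU borel id = DU"
      by (simp add: id_def distr_id2)
    finally show ?thesis .
  qed
  let ?E2 = "{z :: real \<times> real \<times> real. fst z + fst (snd z) \<le> 0 \<and> fst z + snd (snd z) \<le> 0}"
  have E2[measurable]: "?E2 \<in> sets (borel \<Otimes>\<^sub>M borel \<Otimes>\<^sub>M borel)"
  proof -
    have "{z \<in> space (borel \<Otimes>\<^sub>M borel \<Otimes>\<^sub>M borel). fst z + fst (snd z) \<le> (0::real) \<and> fst z + snd (snd z) \<le> 0}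
        \<in> sets (borel \<Otimes>\<^sub>M borel \<Otimes>\<^sub>M borel)"
      by measurable
    then show ?thesis by (simp add: space_pair_measure)
  qed
  have "emeasure M {x \<in> space M. U x + V x \<le> 0} = emeasure (DU \<Otimes>\<^sub>M D) ?E1"
    unfolding Ud[symmetric]
    by (subst emeasure_distr) (auto intro!: arg_cong[where f="emeasure M"])
  also have "\<dots> = (\<integral>\<^sup>+u. emeasure D (Pair u -` ?E1) \<partial>DU)"
    by (intro D.emeasure_pair_measure_alt) (simp cong: sets_pair_measure_cong)
  also have "\<dots> = (\<integral>\<^sup>+u. ennreal (F u) \<partial>DU)"
    by (simp add: vimage_def F_def D.emeasure_eq_measure)
  finally have 1: "prob {x \<in> space M. U x + V x \<le> 0} = (\<integral>u. F u \<partial>DU)"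
    using F01 by (subst integral_eq_nn_integral) (auto simp: measure_def)
  have "emeasure M {x \<in> space M. U x + V x \<le> 0 \<and> U x + V' x \<le> 0} = emeasure (DU \<Otimes>\<^sub>M (D \<Otimes>\<^sub>M D)) ?E2"
    unfolding UVd[symmetric]
    by (subst emeasure_distr) (auto intro!: arg_cong[where f="emeasure M"])
  also have "\<dots> = (\<integral>\<^sup>+u. emeasure (D \<Otimes>\<^sub>M D) (Pair u -` ?E2) \<partial>DU)"
    by (intro DD.emeasure_pair_measure_alt) (simp cong: sets_pair_measure_cong)
  also have "\<dots> = (\<integral>\<^sup>+u. ennreal ((F u)\<^sup>2) \<partial>DU)"
  proof (rule nn_integral_cong)
    fix u
    have "Pair u -` ?E2 = {v. u + v \<le> 0} \<times> {v. u + v \<le> 0}" by auto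
    then show "emeasure (D \<Otimes>\<^sub>M D) (Pair u -` ?E2) = ennreal ((F u)\<^sup>2)"
      by (simp add: D.emeasure_pair_measure_Times F_def D.emeasure_eq_measure power2_eq_square ennreal_mult)
  qed
  finally have 2: "prob {x \<in> space M. U x + V x \<le> 0 \<and> U x + V' x \<le> 0} = (\<integral>u. (F u)\<^sup>2 \<partial>DU)"
    by (subst integral_eq_nn_integral) (auto simp: measure_def)
  have "integrable DU F" "integrable DU (\<lambda>u. (F u)\<^sup>2)"
    using F01 by (auto intro!: DU.integrable_const_bound[where B=1] simp: power_le_one)
  \<comment> \<open>The Jensen step in the form that the variance of \<open>F\<close> is
    nonnegative.\<close>
  then have "0 \<le> (\<integral>u. (F u)\<^sup>2 \<partial>DU) - (\<integral>u. F u \<partial>DU)\<^sup>2"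
    using DU.variance_eq[of F] DU.variance_positive[of F] by simp
  then show ?thesis using 1 2 by simp
qed

section \<open>The received vector\<close>

text \<open>The law of the received vector when 0 is sent: \<open>bpsk 0\<close> is the all-ones
  vector, so every coordinate has mean 1. It lives on functions instead of \<open>real ^ 'n\<close>,
  so that facts on \<open>PiM\<close> apply directly; \<open>word_error_prob_eq\<close> makes the
  transfer.\<close>

locale received_vector =
  fixes \<sigma> :: real and M :: "('n::finite \<Rightarrow> real) measure"
  assumes \<sigma>_pos: "0 < \<sigma>"
    and M_eq: "M = (\<Pi>\<^sub>M t\<in>UNIV. density lborel (normal_density 1 \<sigma>))"
begin

sublocale prob_space M
  unfolding M_eq using \<sigma>_pos by (intro prob_space_PiM prob_space_normal_density)

lemma space_M [simp]: "space M = UNIV"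
  by (simp add: M_eq space_PiM)

lemma sets_M [measurable_cong]: "sets M = sets (\<Pi>\<^sub>M t\<in>UNIV. borel)"
  unfolding M_eq by (rule sets_PiM_cong) auto

lemma distr_coordinate:
  "distr M (density lborel (normal_density 1 \<sigma>)) (\<lambda>y. y t) = density lborel (normal_density 1 \<sigma>)"
  unfolding M_eq using \<sigma>_pos by (intro distr_PiM_component prob_space_normal_density) auto

lemma distributed_coordinate: "distributed M lborel (\<lambda>y. y t) (normal_density 1 \<sigma>)"
proof -
  have "distr M lborel (\<lambda>y. y t) = distr M (density lborel (normal_density 1 \<sigma>)) (\<lambda>y. y t)"
    by (rule distr_cong) auto
  then show ?thesis by (simp add: distributed_def distr_coordinate)
qed

lemma indep_vars_coordinates: "indep_vars (\<lambda>_. borel) (\<lambda>t y. y t) UNIV"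
proof -
  have "distr M borel (\<lambda>y. y t) = density lborel (normal_density 1 \<sigma>)" for t :: 'n
    by (subst distr_coordinate[of t, symmetric]) (rule distr_cong, auto)
  moreover have "distr M (\<Pi>\<^sub>M t\<in>UNIV. borel) (\<lambda>y. y) = M"
    by (rule distr_id2) (simp add: sets_M)
  ultimately show ?thesis
    by (subst indep_vars_iff_distr_eq_PiM') (auto simp: restrict_def M_eq)
qed

lemma indep_coordinate_events:
  assumes ST: "S \<inter> T = {}"
    and A: "Measurable.pred (\<Pi>\<^sub>M t\<in>S. borel) A" and A': "Measurable.pred (\<Pi>\<^sub>M t\<in>T. borel) A'"
  shows "prob {y. A (restrict y S) \<and> A' (restrict y T)}
    = prob {y. A (restrict y S)} * prob {y. A' (restrict y T)}"
proof -
  have "indep_var (\<Pi>\<^sub>M t\<in>S. borel) (\<lambda>y. restrict (\<lambda>t. y t) S) (\<Pi>\<^sub>M t\<in>T. borel) (\<lambda>y. restrict (\<lambda>t. y t) T)"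
    using ST by (intro indep_var_restrict[OF indep_vars_coordinates]) auto
  from indep_varD[OF this, of "{x \<in> space (\<Pi>\<^sub>M t\<in>S. borel). A x}" "{x \<in> space (\<Pi>\<^sub>M t\<in>T. borel). A' x}"]
  show ?thesis
    using A A' by (simp add: vimage_def space_PiM)
qed

lemma distributed_sum:
  assumes "S \<noteq> {}"
  shows "distributed M lborel (\<lambda>y. \<Sum>t\<in>S. y t) (normal_density (card S) (sqrt (card S) * \<sigma>))"
proof -
  have "distributed M lborel (\<lambda>y. \<Sum>t\<in>S. y t) (normal_density (\<Sum>t\<in>S. 1) (sqrt (\<Sum>t\<in>S. \<sigma>\<^sup>2)))"
    using assms \<sigma>_pos
    by (intro sum_indep_normal indep_vars_subset[OF indep_vars_coordinates] distributed_coordinate) auto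
  then show ?thesis using \<sigma>_pos by (simp add: real_sqrt_mult)
qed

lemma prob_sum_nonpos:
  assumes "S \<noteq> {}"
  shows "prob {y. (\<Sum>t\<in>S. y t) \<le> 0} = Q (sqrt (card S) / \<sigma>)"
proof -
  have c: "0 < card S" using assms by (simp add: card_gt_0_iff)
  have "prob {y \<in> space M. (\<Sum>t\<in>S. y t) \<le> 0} = Q (card S / (sqrt (card S) * \<sigma>))"
    using c \<sigma>_pos by (intro prob_normal_nonpos[OF distributed_sum[OF assms]]) auto
  also have "card S / (sqrt (card S) * \<sigma>) = sqrt (card S) / \<sigma>"
    using real_div_sqrt[of "real (card S)"] by (simp add: divide_divide_eq_left[symmetric])
  finally show ?thesis by simp
qed

lemma prob_sum_eq_0:
  assumes "S \<noteq> {}"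
  shows "prob {y. (\<Sum>t\<in>S. y t) = 0} = 0"
  using prob_distributed_lborel_eq[OF distributed_sum[OF assms], of 0] by simp

lemma prob_coordinate_nonpos: "prob {y. y t \<le> 0} = Q (1 / \<sigma>)"
  using prob_sum_nonpos[of "{t}"] by simp

text \<open>Positive correlation of two pairwise errors. Both sums contain the sum over
  \<open>S \<inter> S'\<close>; the remainders run over disjoint sets of equal size, so they are
  independent and have the same normal law.\<close>

lemma prob_sum_nonpos_pair:
  assumes S: "card S = card S'" "S \<noteq> S'"
  shows "(Q (sqrt (card S) / \<sigma>))\<^sup>2 \<le> prob {y. (\<Sum>t\<in>S. y t) \<le> 0 \<and> (\<Sum>t\<in>S'. y t) \<le> 0}"
proof -
  define U V V' :: "('n \<Rightarrow> real) \<Rightarrow> real"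
    where "U = (\<lambda>y. \<Sum>t\<in>S \<inter> S'. y t)" and "V = (\<lambda>y. \<Sum>t\<in>S - S'. y t)" and "V' = (\<lambda>y. \<Sum>t\<in>S' - S. y t)"
  have meas: "U \<in> borel_measurable M" "V \<in> borel_measurable M" "V' \<in> borel_measurable M"
    by (simp_all add: U_def V_def V'_def)
  have UV: "U y + V y = (\<Sum>t\<in>S. y t)" for y
    unfolding U_def V_def by (rule sum.Int_Diff[symmetric]) simp
  have UV': "U y + V' y = (\<Sum>t\<in>S'. y t)" for y
    unfolding U_def V'_def by (subst Int_commute) (rule sum.Int_Diff[symmetric], simp)
  have "card (S \<inter> S') + card (S - S') = card S" "card (S \<inter> S') + card (S' - S) = card S'"
    using card_Int_Diff[of S S'] card_Int_Diff[of S' S] by (simp_all add: Int_commute)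
  then have c: "card (S - S') = card (S' - S)" using S by simp
  \<comment> \<open>The law of a block sum is known only for nonempty blocks; distinct sets of equal
    size have nonempty differences on both sides.\<close>
  have ne: "S - S' \<noteq> {}"
  proof
    assume "S - S' = {}"
    then have "card (S' - S) = 0" using c by (simp only: card.empty)
    then have "S' - S = {}" by (simp only: card_eq_0_iff finite) simp
    then show False using \<open>S - S' = {}\<close> S by blast
  qed
  then have ne': "S' - S \<noteq> {}" using c by (metis card_eq_0_iff finite)
  \<comment> \<open>Independence is available for vectors restricted to disjoint blocks.
    \<open>U\<close> reads only the first block and \<open>(V, V')\<close> only the second, so
    \<open>r\<close> can drop the restrictions afterwards.\<close>
  have "indep_var (\<Pi>\<^sub>M t\<in>S \<inter> S'. borel) (\<lambda>y. restrict (\<lambda>t. y t) (S \<inter> S'))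
      (\<Pi>\<^sub>M t\<in>(S - S') \<union> (S' - S). borel) (\<lambda>y. restrict (\<lambda>t. y t) ((S - S') \<union> (S' - S)))"
    by (intro indep_var_restrict[OF indep_vars_coordinates]) auto
  then have 1: "distr M (borel \<Otimes>\<^sub>M borel \<Otimes>\<^sub>M borel) (\<lambda>x. (U (restrict x (S \<inter> S')),
        (\<lambda>z. (V z, V' z)) (restrict x ((S - S') \<union> (S' - S)))))
      = distr M borel (\<lambda>x. U (restrict x (S \<inter> S'))) \<Otimes>\<^sub>M
        distr M (borel \<Otimes>\<^sub>M borel) (\<lambda>x. (\<lambda>z. (V z, V' z)) (restrict x ((S - S') \<union> (S' - S))))"
    by (rule distr_Pair_compose_indep_var)
      (auto simp: U_def V_def V'_def intro!: borel_measurable_sum measurable_Pair measurable_component_singleton)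
  have "indep_var (\<Pi>\<^sub>M t\<in>S - S'. borel) (\<lambda>y. restrict (\<lambda>t. y t) (S - S'))
      (\<Pi>\<^sub>M t\<in>S' - S. borel) (\<lambda>y. restrict (\<lambda>t. y t) (S' - S))"
    by (intro indep_var_restrict[OF indep_vars_coordinates]) auto
  then have "indep_var borel (V \<circ> (\<lambda>y. restrict (\<lambda>t. y t) (S - S'))) borel (V' \<circ> (\<lambda>y. restrict (\<lambda>t. y t) (S' - S)))"
    by (rule indep_var_compose)
      (auto simp: V_def V'_def intro!: borel_measurable_sum measurable_component_singleton)
  then have 2: "indep_var borel V borel V'"
    by (simp add: comp_def V_def V'_def)
  have "distr M lborel V' = distr M lborel V"
    using distributed_distr_eq_density[OF distributed_sum[OF ne]]
      distributed_distr_eq_density[OF distributed_sum[OF ne']] c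
    by (simp add: V_def V'_def)
  then have 3: "distr M borel V' = distr M borel V"
    by (simp cong: distr_cong)
  have r: "U (restrict x (S \<inter> S')) = U x" "V (restrict x ((S - S') \<union> (S' - S))) = V x"
      "V' (restrict x ((S - S') \<union> (S' - S))) = V' x" for x
    by (auto simp: U_def V_def V'_def intro!: sum.cong)
  have "S \<noteq> {}" using ne by auto
  then show ?thesis
    using power2_prob_le_prob_common_summand[OF meas 1[unfolded r] 2 3] prob_sum_nonpos[of S]
    by (simp add: UV UV')
qed

section \<open>Error counts of the hard decision\<close>

definition sign_errors :: "'n set \<Rightarrow> ('n \<Rightarrow> real) \<Rightarrow> nat" where
  "sign_errors T y = card {t \<in> T. y t \<le> 0}"

lemma sign_errors_restrict: "sign_errors T (restrict y T) = sign_errors T y"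
  unfolding sign_errors_def by (intro arg_cong[where f=card]) auto

lemma sign_errors_eq_sum: "sign_errors T y = (\<Sum>t\<in>T. if y t \<le> 0 then 1 else 0)"
  by (simp add: sign_errors_def sum.If_cases Int_def)

lemma measurable_sign_errors_PiM:
  "sign_errors T \<in> measurable (\<Pi>\<^sub>M t\<in>T. borel) (count_space UNIV)"
  unfolding sign_errors_eq_sum[abs_def] by measurable

lemma measurable_sign_errors [measurable]: "sign_errors T \<in> measurable M (count_space UNIV)"
  unfolding sign_errors_eq_sum[abs_def] by measurable

text \<open>Fixing the set of erroneous positions in \<open>T\<close> is a box condition: a
  half-line for each coordinate in \<open>T\<close>, no constraint elsewhere. The probability is
  therefore a product.\<close>

lemma prob_sign_pattern:
  assumes "A \<subseteq> T"
  shows "prob {y. {t \<in> T. y t \<le> 0} = A} = Q (1 / \<sigma>) ^ card A * (1 - Q (1 / \<sigma>)) ^ (card T - card A)"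
proof -
  let ?p = "Q (1 / \<sigma>)" and ?N = "density lborel (normal_density 1 \<sigma>)"
  interpret N: prob_space ?N using \<sigma>_pos by (rule prob_space_normal_density)
  interpret P: finite_product_prob_space "\<lambda>_::'n. ?N" UNIV by unfold_locales simp
  have N0: "N.prob {..0} = ?p"
  proof -
    \<comment> \<open>\<open>undefined\<close> serves as an arbitrary coordinate; all of them have
      the same law.\<close>
    have "N.prob {..0} = measure (distr M ?N (\<lambda>y. y undefined)) {..0}"
      by (simp only: distr_coordinate)
    also have "\<dots> = prob {y. y undefined \<le> 0}"
      by (subst measure_distr) (auto simp: vimage_def)
    finally show ?thesis by (simp add: prob_coordinate_nonpos)
  qed
  have N1: "N.prob {0<..} = 1 - ?p"
    using N.prob_compl[of "{..0}"] by (simp add: N0 Compl_eq_Diff_UNIV[symmetric] not_le)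
  define X :: "'n \<Rightarrow> real set"
    where "X t = (if t \<in> A then {..0} else if t \<in> T then {0<..} else UNIV)" for t
  have "{y :: 'n \<Rightarrow> real. {t \<in> T. y t \<le> 0} = A} = (\<Pi>\<^sub>E t\<in>UNIV. X t)"
  proof (intro set_eqI iffI)
    fix y :: "'n \<Rightarrow> real" assume "y \<in> {y. {t \<in> T. y t \<le> 0} = A}"
    then have "A = {t \<in> T. y t \<le> 0}" by simp
    then show "y \<in> (\<Pi>\<^sub>E t\<in>UNIV. X t)" by (simp add: X_def PiE_iff not_le)
  next
    fix y :: "'n \<Rightarrow> real" assume "y \<in> (\<Pi>\<^sub>E t\<in>UNIV. X t)"
    then have y: "y t \<in> X t" for t by (simp add: PiE_iff)
    have "t \<in> A \<longleftrightarrow> t \<in> T \<and> y t \<le> 0" for t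
      using y[of t] assms by (cases "t \<in> A"; cases "t \<in> T") (auto simp: X_def)
    then show "y \<in> {y. {t \<in> T. y t \<le> 0} = A}" by blast
  qed
  then have "prob {y. {t \<in> T. y t \<le> 0} = A} = (\<Prod>t\<in>UNIV. N.prob (X t))"
    unfolding M_eq by (simp add: P.prob_times X_def)
  also have "\<dots> = (\<Prod>t\<in>UNIV. (if t \<in> A then ?p else 1) * (if t \<in> T - A then 1 - ?p else 1))"
    using assms N.prob_space by (intro prod.cong refl) (auto simp: X_def N0 N1)
  also have "\<dots> = ?p ^ card A * (1 - ?p) ^ card (T - A)"
    by (simp only: prod.distrib prod.If_cases finite) (simp add: set_diff_eq)
  finally show ?thesis using assms by (simp add: card_Diff_subset)
qed

text \<open>The event splits disjointly by the exact error set \<open>A\<close>. The probability of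
  a pattern depends only on \<open>card A\<close>, and grouping by cardinality yields the binomial
  coefficients.\<close>

lemma prob_sign_errors: "prob {y. l \<le> sign_errors T y \<and> sign_errors T y \<le> u} = B (Q (1 / \<sigma>)) (card T) l u"
proof -
  let ?p = "Q (1 / \<sigma>)"
  let ?AA = "{A. A \<subseteq> T \<and> l \<le> card A \<and> card A \<le> u}"
  have eq: "{y. l \<le> sign_errors T y \<and> sign_errors T y \<le> u} = (\<Union>A\<in>?AA. {y. {t \<in> T. y t \<le> 0} = A})"
    by (auto simp: sign_errors_def)
  have meas: "{y. {t \<in> T. y t \<le> 0} = A} \<in> sets M" for A
  proof -
    have "{y \<in> space M. \<forall>t\<in>UNIV. (t \<in> T \<and> y t \<le> 0) = (t \<in> A)} \<in> sets M" by measurable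
    then show ?thesis by (simp add: set_eq_iff)
  qed
  have "prob {y. l \<le> sign_errors T y \<and> sign_errors T y \<le> u} = (\<Sum>A\<in>?AA. prob {y. {t \<in> T. y t \<le> 0} = A})"
    unfolding eq using meas
    by (intro finite_measure_finite_Union) (auto simp: disjoint_family_on_def)
  also have "\<dots> = (\<Sum>A\<in>?AA. ?p ^ card A * (1 - ?p) ^ (card T - card A))"
    by (intro sum.cong refl prob_sign_pattern) auto
  also have "\<dots> = (\<Sum>m\<in>{l..u}. \<Sum>A | A \<in> ?AA \<and> card A = m. ?p ^ card A * (1 - ?p) ^ (card T - card A))"
    by (rule sum.group[symmetric]) auto
  also have "\<dots> = (\<Sum>m\<in>{l..u}. real (card T choose m) * ?p ^ m * (1 - ?p) ^ (card T - m))"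
  proof (rule sum.cong[OF refl])
    fix m assume m: "m \<in> {l..u}"
    then have "{A. A \<in> ?AA \<and> card A = m} = {A. A \<subseteq> T \<and> card A = m}" by auto
    then show "(\<Sum>A | A \<in> ?AA \<and> card A = m. ?p ^ card A * (1 - ?p) ^ (card T - card A))
        = real (card T choose m) * ?p ^ m * (1 - ?p) ^ (card T - m)"
      using n_subsets[of T m] by (simp add: mult.assoc)
  qed
  finally show ?thesis by (simp add: B_def)
qed

end

section \<open>List decoding\<close>

abbreviation supp :: "'n::finite word \<Rightarrow> 'n set" where
  "supp c \<equiv> {t. c $ t \<noteq> 0}"

lemma supp_inject: "supp c = supp c' \<longleftrightarrow> c = c'"
proof
  assume eq: "supp c = supp c'"
  have "c $ t = c' $ t" for t
    using arg_cong[OF eq, of "\<lambda>S. t \<in> S"] by (cases "c $ t"; cases "c' $ t") auto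
  then show "c = c'" by (simp add: vec_eq_iff)
qed simp

lemma finite_words [simp]: "finite (C :: 'n::finite word set)"
  by (rule finite_imageD[of supp]) (simp_all only: inj_on_def supp_inject finite, simp)

lemma supp_eq_empty_iff: "supp c = {} \<longleftrightarrow> c = 0"
  using supp_inject[of c 0] by simp

lemma word_add_self: "c + c = (0 :: 'n::finite word)"
  by (simp add: vec_eq_iff)

lemma word_add_cancel: "c + (c + c') = (c' :: 'n::finite word)"
  by (simp add: word_add_self flip: add.assoc)

lemma bpsk_nth: "bpsk c $ t = (if c $ t = 0 then 1 else - 1)"
  by (simp add: bpsk_def)

lemma bpsk_add_nth: "bpsk (c + c') $ t = bpsk c $ t * bpsk c' $ t"
  by (cases "c $ t"; cases "c' $ t") (simp_all add: bpsk_nth)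

definition correlation :: "'n::finite word \<Rightarrow> ('n \<Rightarrow> real) \<Rightarrow> real" where
  "correlation c y = (\<Sum>t\<in>UNIV. bpsk c $ t * y t)"

text \<open>Hamming distance from \<open>c\<close> to the hard decision of \<open>y\<close>, except
  that a coordinate equal to 0 disagrees with every word.\<close>

definition sign_distance :: "'n::finite word \<Rightarrow> ('n \<Rightarrow> real) \<Rightarrow> nat" where
  "sign_distance c y = card {t. bpsk c $ t * y t \<le> 0}"

definition sign_flip :: "'n::finite word \<Rightarrow> ('n \<Rightarrow> real) \<Rightarrow> 'n \<Rightarrow> real" where
  "sign_flip c y = (\<lambda>t. bpsk c $ t * y t)"

text \<open>\<open>bpsk\<close> turns addition of words into products of signs, so flipping the
  received signs by \<open>c\<close> amounts to translating the code by \<open>c\<close>.\<close>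

lemma correlation_sign_flip: "correlation c' (sign_flip c y) = correlation (c + c') y"
  by (simp add: correlation_def sign_flip_def bpsk_add_nth mult_ac)

lemma sign_distance_sign_flip: "sign_distance c' (sign_flip c y) = sign_distance (c + c') y"
  by (simp add: sign_distance_def sign_flip_def bpsk_add_nth mult_ac)

lemma sign_flip_sign_flip: "sign_flip c (sign_flip c y) = y"
  by (auto simp: sign_flip_def bpsk_nth fun_eq_iff)

text \<open>The signs of 0 and \<open>c\<close> differ exactly on \<open>supp c\<close>, by 2. So
  \<open>c\<close> is at least as likely as 0 exactly when the sum over \<open>supp c\<close> is
  nonpositive.\<close>

lemma correlation_zero_minus: "correlation 0 y - correlation c y = 2 * (\<Sum>t\<in>supp c. y t)"
proof -
  have "correlation 0 y - correlation c y = (\<Sum>t\<in>UNIV. if t \<in> supp c then 2 * y t else 0)"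
    unfolding correlation_def sum_subtractf[symmetric] by (intro sum.cong) (auto simp: bpsk_nth)
  also have "\<dots> = (\<Sum>t\<in>supp c. 2 * y t)" by (simp add: sum.If_cases)
  finally show ?thesis by (simp add: sum_distrib_left)
qed

text \<open>All BPSK images have the same norm, so nearest means most correlated.\<close>

lemma dist_bpsk_le_iff:
  "dist (\<chi> t. y t) (bpsk c) \<le> dist (\<chi> t. y t) (bpsk c') \<longleftrightarrow> correlation c' y \<le> correlation c y"
proof -
  have sq: "(\<Sum>t\<in>UNIV. (dist (y t) (bpsk c $ t))\<^sup>2) = (\<Sum>t\<in>UNIV. (y t)\<^sup>2 + 1) - 2 * correlation c y"
    for c :: "'a word"
  proof -
    have "(dist (y t) (bpsk c $ t))\<^sup>2 = ((y t)\<^sup>2 + 1) - 2 * (bpsk c $ t * y t)" for t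
      by (auto simp: dist_real_def bpsk_nth power2_eq_square algebra_simps)
    then show ?thesis
      by (simp only: sum_subtractf correlation_def sum_distrib_left)
  qed
  show ?thesis
    by (simp add: dist_vec_def L2_set_def sq)
qed

text \<open>A triangle inequality: on \<open>supp c\<close> the signs of 0 and \<open>c\<close> are
  opposite, so each such coordinate disagrees with at least one of them. Two words on the same list
  hence have distance at most \<open>2 * ds\<close>.\<close>

lemma hamming_weight_le_sign_distances: "hamming_weight c \<le> sign_distance 0 y + sign_distance c y"
proof -
  have "supp c \<subseteq> {t. bpsk 0 $ t * y t \<le> 0} \<union> {t. bpsk c $ t * y t \<le> 0}"
    by (auto simp: bpsk_nth)
  then have "card (supp c) \<le> card ({t. bpsk 0 $ t * y t \<le> 0} \<union> {t. bpsk c $ t * y t \<le> 0})"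
    by (intro card_mono) auto
  also have "\<dots> \<le> sign_distance 0 y + sign_distance c y"
    unfolding sign_distance_def by (rule card_Un_le)
  finally show ?thesis by (simp add: hamming_weight_def)
qed

text \<open>The weak inequality puts a tie into the region of every maximiser, so these regions
  cover the space. The strict one in \<open>list_region\<close> makes those regions disjoint
  instead; the comparison of the two decoders uses both facts.\<close>

definition ml_region :: "'n::finite code \<Rightarrow> 'n word \<Rightarrow> ('n \<Rightarrow> real) set" where
  "ml_region C c = {y. \<forall>c'\<in>C. correlation c' y \<le> correlation c y}"

text \<open>
  Correct-decision region of the list decoder that picks the best codeword among those within
  Hamming distance \<open>ds\<close> of the hard decision. A coordinate \<open>y t = 0\<close> counts as a sign error for both
  bits, which keeps the region equivariant under \<open>sign_flip\<close>.
\<close>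

definition list_region :: "nat \<Rightarrow> 'n::finite code \<Rightarrow> 'n word \<Rightarrow> ('n \<Rightarrow> real) set" where
  "list_region ds C c = {y. sign_distance c y \<le> ds \<and>
     (\<forall>c'\<in>C. c' \<noteq> c \<longrightarrow> sign_distance c' y \<le> ds \<longrightarrow> correlation c' y < correlation c y)}"

lemma linear_code_zero: "linear_code C \<Longrightarrow> 0 \<in> C"
  by (simp add: linear_code_def vec.subspace_0)

lemma linear_code_add: "linear_code C \<Longrightarrow> c \<in> C \<Longrightarrow> c' \<in> C \<Longrightarrow> c + c' \<in> C"
  by (simp add: linear_code_def vec.subspace_add)

text \<open>Adding \<open>c\<close> is an involution in characteristic 2, so closure under addition
  gives both inclusions.\<close>

lemma linear_code_translate:
  assumes "linear_code C" "c \<in> C"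
  shows "(+) c ` C = C"
proof -
  have "(+) c ` C \<subseteq> C" using assms by (auto intro: linear_code_add)
  moreover have "C \<subseteq> (+) c ` ((+) c ` C)" by (auto simp: image_image word_add_cancel)
  ultimately show ?thesis by blast
qed

text \<open>The competitors are reindexed by translation with \<open>c\<close>, which permutes the
  code.\<close>

lemma sign_flip_in_ml_region_iff:
  assumes "linear_code C" "c \<in> C"
  shows "sign_flip c y \<in> ml_region C c' \<longleftrightarrow> y \<in> ml_region C (c + c')"
proof -
  have "y \<in> ml_region C (c + c') \<longleftrightarrow> (\<forall>x\<in>(+) c ` C. correlation x y \<le> correlation (c + c') y)"
    by (simp add: ml_region_def linear_code_translate[OF assms])
  then show ?thesis by (simp add: ml_region_def correlation_sign_flip)
qed

lemma sign_flip_in_list_region_iff: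
  assumes "linear_code C" "c \<in> C"
  shows "sign_flip c y \<in> list_region ds C c' \<longleftrightarrow> y \<in> list_region ds C (c + c')"
proof -
  have "y \<in> list_region ds C (c + c') \<longleftrightarrow> sign_distance (c + c') y \<le> ds \<and> (\<forall>x\<in>(+) c ` C.
     x \<noteq> c + c' \<longrightarrow> sign_distance x y \<le> ds \<longrightarrow> correlation x y < correlation (c + c') y)"
    by (simp add: list_region_def linear_code_translate[OF assms])
  then show ?thesis
    by (simp add: list_region_def correlation_sign_flip sign_distance_sign_flip)
qed

lemma disjoint_family_list_region: "disjoint_family_on (list_region ds C) C"
  by (auto simp: disjoint_family_on_def list_region_def) (metis less_asym)

lemma UN_ml_region:
  assumes "linear_code C"
  shows "(\<Union>c\<in>C. ml_region C c) = UNIV"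
proof -
  have "\<exists>c\<in>C. y \<in> ml_region C c" for y
  proof -
    have C: "finite C" "C \<noteq> {}" using linear_code_zero[OF assms] by auto
    have "Max ((\<lambda>c. correlation c y) ` C) \<in> (\<lambda>c. correlation c y) ` C"
      using C by (intro Max_in) auto
    then obtain c where "c \<in> C" "Max ((\<lambda>c. correlation c y) ` C) = correlation c y" by blast
    moreover have "\<forall>c'\<in>C. correlation c' y \<le> Max ((\<lambda>c. correlation c y) ` C)"
      using C by auto
    ultimately show ?thesis by (auto simp: ml_region_def)
  qed
  then show ?thesis by blast
qed

lemma measurable_correlation [measurable]: "correlation c \<in> borel_measurable (\<Pi>\<^sub>M t\<in>UNIV. borel)"
  unfolding correlation_def[abs_def] by measurable

lemma measurable_sign_distance [measurable]:
  "sign_distance c \<in> measurable (\<Pi>\<^sub>M t\<in>UNIV. borel) (count_space UNIV)"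
proof -
  have "sign_distance c = (\<lambda>y. \<Sum>t\<in>UNIV. if bpsk c $ t * y t \<le> 0 then 1 else 0)"
    by (simp add: sign_distance_def fun_eq_iff sum.If_cases)
  also have "\<dots> \<in> measurable (\<Pi>\<^sub>M t\<in>UNIV. borel) (count_space UNIV)" by measurable
  finally show ?thesis .
qed

context received_vector
begin

lemma sets_ml_region [measurable]: "ml_region C c \<in> sets M"
proof -
  have [measurable]: "correlation c \<in> borel_measurable M" for c
    by measurable
  have "{y \<in> space M. correlation c' y \<le> correlation c y} \<in> sets M" for c'
    by (intro borel_measurable_le) measurable
  then have "{y \<in> space M. \<forall>c'\<in>C. correlation c' y \<le> correlation c y} \<in> sets M"
    by (intro sets.sets_Collect_finite_All) auto
  then show ?thesis by (simp add: ml_region_def)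
qed

lemma sets_list_region [measurable]: "list_region ds C c \<in> sets M"
proof -
  have "{y \<in> space M. sign_distance c y \<le> ds \<and> (\<forall>c'\<in>C. c' \<noteq> c \<longrightarrow> sign_distance c' y \<le> ds \<longrightarrow>
      correlation c' y < correlation c y)} \<in> sets M" by measurable
  then show ?thesis by (simp add: list_region_def)
qed

section \<open>Change of measure under sign flips\<close>

lemma measurable_sign_flip [measurable]: "sign_flip c \<in> measurable M M"
proof -
  have "(\<lambda>y. \<lambda>t\<in>UNIV. bpsk c $ t * y t) \<in> measurable M (\<Pi>\<^sub>M t\<in>UNIV. borel)"
    by (intro measurable_restrict) measurable
  moreover have "(\<lambda>y. \<lambda>t\<in>UNIV. bpsk c $ t * y t) = sign_flip c"
    by (simp add: sign_flip_def fun_eq_iff)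
  ultimately show ?thesis
    by (simp only: measurable_cong_sets[OF refl sets_M])
qed

text \<open>Sign flips preserve Lebesgue measure, so the change of variables leaves only the density
  at the flipped point. On \<open>A\<close> that density is at most the original one, because there
  0 is at least as likely as \<open>c\<close>.\<close>

lemma prob_vimage_sign_flip_le:
  assumes A[measurable]: "A \<in> sets M" and le: "\<And>y. y \<in> A \<Longrightarrow> correlation c y \<le> correlation 0 y"
  shows "prob (sign_flip c -` A) \<le> prob A"
proof -
  define L :: "('n \<Rightarrow> real) measure" where "L = (\<Pi>\<^sub>M t\<in>UNIV. lborel)"
  define f :: "('n \<Rightarrow> real) \<Rightarrow> ennreal" where "f y = (\<Prod>t\<in>UNIV. ennreal (normal_density 1 \<sigma> (y t)))" for y
  have M: "M = density L f"
    unfolding M_eq L_def f_def[abs_def] using \<sigma>_pos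
    by (intro density_PiM)
      (auto intro: prob_space_imp_sigma_finite prob_space_normal_density lborel.sigma_finite_measure_axioms)
  have sets_L[measurable_cong]: "sets L = sets M" by (simp add: M)
  have f[measurable]: "f \<in> borel_measurable M"
    unfolding f_def[abs_def] by measurable
  have flip[measurable]: "sign_flip c \<in> measurable L L"
    using measurable_sign_flip[of c] by (simp add: sets_L cong: measurable_cong_sets)
  have "distr lborel lborel (\<lambda>x. bpsk c $ t * x) = lborel" for t
  proof (cases "c $ t = 0")
    case True
    then show ?thesis by (simp add: bpsk_nth distr_id2)
  next
    case False
    have "distr lborel lborel (\<lambda>x::real. - x) = distr lborel borel uminus"
      by (rule distr_cong) auto
    then show ?thesis using False lborel_distr_uminus by (simp add: bpsk_nth)
  qed
  then have "distr L L (\<lambda>y. \<lambda>t\<in>UNIV. bpsk c $ t * y t) = L"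
    unfolding L_def by (intro distr_PiM_coordinatewise lborel.sigma_finite_measure_axioms) auto
  moreover have "(\<lambda>y. \<lambda>t\<in>UNIV. bpsk c $ t * y t) = sign_flip c"
    by (simp add: sign_flip_def fun_eq_iff)
  ultimately have L: "distr L L (sign_flip c) = L" by simp
  have f_eq: "f y = ennreal ((1 / sqrt (2 * pi * \<sigma>\<^sup>2)) ^ CARD('n) * exp (- (\<Sum>t\<in>UNIV. (y t - 1)\<^sup>2) / (2 * \<sigma>\<^sup>2)))" for y
  proof -
    have "(\<Prod>t\<in>UNIV. exp (- ((y t - 1)\<^sup>2 / (2 * \<sigma>\<^sup>2)))) = exp (- (\<Sum>t\<in>UNIV. (y t - 1)\<^sup>2) / (2 * \<sigma>\<^sup>2))"
      by (simp add: exp_sum[symmetric] sum_negf sum_divide_distrib)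
    then show ?thesis
      by (simp add: f_def prod_ennreal normal_density_nonneg normal_density_def prod.distrib
        power_one_over prod_dividef)
  qed
  have f_le: "f (sign_flip c y) \<le> f y" if "y \<in> A" for y
  proof -
    \<comment> \<open>Summed over \<open>t\<close>, this is the squared distance from
      \<open>y\<close> to \<open>bpsk c\<close>; thus \<open>f (sign_flip c y)\<close> is the
      likelihood of \<open>c\<close> at \<open>y\<close>.\<close>
    have "(sign_flip c y t - 1)\<^sup>2 = (y t)\<^sup>2 + 1 - 2 * (bpsk c $ t * y t)" for t
      by (auto simp: sign_flip_def bpsk_nth power2_eq_square algebra_simps)
    then have "(\<Sum>t\<in>UNIV. (sign_flip c y t - 1)\<^sup>2) = (\<Sum>t\<in>UNIV. (y t)\<^sup>2 + 1) - 2 * correlation c y"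
      by (simp only: sum_subtractf correlation_def sum_distrib_left)
    moreover have "(y t - 1)\<^sup>2 = (y t)\<^sup>2 + 1 - 2 * (bpsk 0 $ t * y t)" for t
      by (auto simp: bpsk_nth power2_eq_square algebra_simps)
    then have "(\<Sum>t\<in>UNIV. (y t - 1)\<^sup>2) = (\<Sum>t\<in>UNIV. (y t)\<^sup>2 + 1) - 2 * correlation 0 y"
      by (simp only: sum_subtractf correlation_def sum_distrib_left)
    ultimately have "(\<Sum>t\<in>UNIV. (y t - 1)\<^sup>2) \<le> (\<Sum>t\<in>UNIV. (sign_flip c y t - 1)\<^sup>2)"
      using le[OF that] by simp
    then show ?thesis
      unfolding f_eq by (intro ennreal_leI mult_left_mono) (auto intro!: divide_right_mono)
  qed
  have emeasure_M: "emeasure M X = (\<integral>\<^sup>+y. f y * indicator X y \<partial>L)" if "X \<in> sets M" for X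
  proof -
    have "emeasure M X = emeasure (density L f) X" by (simp only: M[symmetric])
    then show ?thesis using that f sets_L by (simp add: emeasure_density cong: measurable_cong_sets)
  qed
  have "sign_flip c -` A \<in> sets M"
    using measurable_sets[OF measurable_sign_flip A, of c] by simp
  then have "emeasure M (sign_flip c -` A) = (\<integral>\<^sup>+y. f y * indicator A (sign_flip c y) \<partial>L)"
    by (simp add: emeasure_M indicator_def)
  \<comment> \<open>Replacing \<open>L\<close> by its image under the flip moves the flip from the
    indicator to \<open>f\<close>, since flipping twice is the identity.\<close>
  also have "\<dots> = (\<integral>\<^sup>+y. f y * indicator A (sign_flip c y) \<partial>distr L L (sign_flip c))"
    by (simp add: L)
  also have "\<dots> = (\<integral>\<^sup>+y. f (sign_flip c y) * indicator A y \<partial>L)"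
    by (subst nn_integral_distr) (auto simp: sign_flip_sign_flip)
  also have "\<dots> \<le> (\<integral>\<^sup>+y. f y * indicator A y \<partial>L)"
    using f_le by (intro nn_integral_mono) (auto split: split_indicator)
  also have "\<dots> = emeasure M A"
    by (simp add: emeasure_M)
  finally show ?thesis by (simp add: emeasure_eq_measure)
qed

text \<open>
  Flipping by \<open>c\<close> moves \<open>list_region 0 \<inter> ml_region c\<close> to \<open>list_region c \<inter> ml_region 0\<close>, where
  the density for the transmitted word \<open>0\<close> exceeds the one for \<open>c\<close>.
\<close>

lemma prob_list_region_le_prob_ml_region:
  assumes C: "linear_code C"
  shows "prob (list_region ds C 0) \<le> prob (ml_region C 0)"
proof -
  \<comment> \<open>The ML regions may overlap at ties, but an upper bound only needs a
    cover.\<close>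
  have "list_region ds C 0 = (\<Union>c\<in>C. list_region ds C 0 \<inter> ml_region C c)"
    using UN_ml_region[OF C] by blast
  then have "prob (list_region ds C 0) = prob (\<Union>c\<in>C. list_region ds C 0 \<inter> ml_region C c)"
    by simp
  also have "\<dots> \<le> (\<Sum>c\<in>C. prob (list_region ds C 0 \<inter> ml_region C c))"
    using sets_list_region sets_ml_region by (intro finite_measure_subadditive_finite) auto
  also have "\<dots> \<le> (\<Sum>c\<in>C. prob (list_region ds C c \<inter> ml_region C 0))"
  proof (rule sum_mono)
    fix c assume c: "c \<in> C"
    \<comment> \<open>Translation by \<open>c\<close> exchanges 0 and \<open>c\<close>, since
      \<open>c + c = 0\<close>.\<close>
    have "list_region ds C 0 \<inter> ml_region C c = sign_flip c -` (list_region ds C c \<inter> ml_region C 0)"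
      using sign_flip_in_list_region_iff[OF C c, of _ ds c] sign_flip_in_ml_region_iff[OF C c, of _ 0]
      by (auto simp: word_add_self)
    also have "prob \<dots> \<le> prob (list_region ds C c \<inter> ml_region C 0)"
    proof (rule prob_vimage_sign_flip_le)
      show "correlation c y \<le> correlation 0 y" if "y \<in> list_region ds C c \<inter> ml_region C 0" for y
        using c that by (simp add: ml_region_def)
    qed simp
    finally show "prob (list_region ds C 0 \<inter> ml_region C c) \<le> prob (list_region ds C c \<inter> ml_region C 0)" .
  qed
  \<comment> \<open>Disjointness of the list regions turns the sum back into a single
    probability.\<close>
  also have "\<dots> = prob (\<Union>c\<in>C. list_region ds C c \<inter> ml_region C 0)"
    using disjoint_family_list_region[of ds C]
    by (intro finite_measure_finite_Union[symmetric]) (auto simp: disjoint_family_on_def)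
  also have "\<dots> \<le> prob (ml_region C 0)"
    by (intro finite_measure_mono) auto
  finally show ?thesis .
qed

section \<open>Union bounds\<close>

lemma card_Compl_UNIV: "card (- S) = CARD('n) - card (S :: 'n set)"
  by (simp add: Compl_eq_Diff_UNIV card_Diff_subset)

lemma sum_restrict: "S \<subseteq> T \<Longrightarrow> sum (restrict y T) S = sum y S"
  by (rule sum.cong) auto

text \<open>\<open>A_restrict\<close> says that \<open>A\<close> depends only on the coordinates in
  \<open>S\<close>; the error count depends only on those in the disjoint set \<open>T\<close>, so
  the probabilities multiply.\<close>

lemma prob_conj_sign_errors:
  assumes "S \<inter> T = {}" and A: "Measurable.pred (\<Pi>\<^sub>M t\<in>S. borel) A"
    and A_restrict: "\<And>y. A (restrict y S) = A y"
  shows "prob {y. A y \<and> sign_errors T y \<le> k} = prob {y. A y} * B (Q (1 / \<sigma>)) (card T) 0 k"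
proof -
  have [measurable]: "sign_errors T \<in> measurable (\<Pi>\<^sub>M t\<in>T. borel) (count_space UNIV)"
    by (rule measurable_sign_errors_PiM)
  have "Measurable.pred (\<Pi>\<^sub>M t\<in>T. borel) (\<lambda>y. sign_errors T y \<le> k)"
    by measurable
  from indep_coordinate_events[OF assms(1) A this]
  show ?thesis
    using prob_sign_errors[of 0 T k] by (simp add: A_restrict sign_errors_restrict)
qed

text \<open>A nonpositive sum has a nonpositive term, so at least one error lies in
  \<open>S\<close>. The truncated \<open>ds - 1\<close> is harmless: that error excludes
  \<open>ds = 0\<close>.\<close>

lemma sign_errors_outside_le:
  assumes "sign_errors UNIV y \<le> ds" "(\<Sum>t\<in>S. y t) \<le> 0" "S \<noteq> {}" "S \<inter> T = {}"
  shows "sign_errors T y \<le> ds - 1"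
proof -
  obtain t where t: "t \<in> S" "y t \<le> 0"
    using sum_pos[of S y] assms(2,3) by (force simp: not_le)
  have "card (insert t {t \<in> T. y t \<le> 0}) \<le> card {t \<in> UNIV. y t \<le> 0}"
    using t by (intro card_mono) auto
  moreover have "t \<notin> {t \<in> T. y t \<le> 0}" using t assms(4) by auto
  ultimately show ?thesis using assms(1) by (simp add: sign_errors_def)
qed

text \<open>Contains the event that a listed codeword of weight \<open>d\<close> misleads the list
  decoder. Membership in the list enters only through the range of \<open>d\<close> in
  \<open>compl_list_region_subset\<close>.\<close>

definition list_error :: "nat \<Rightarrow> 'n code \<Rightarrow> nat \<Rightarrow> ('n \<Rightarrow> real) set" where
  "list_error ds C d =
     {y. sign_errors UNIV y \<le> ds \<and> (\<exists>c\<in>C. hamming_weight c = d \<and> (\<Sum>t\<in>supp c. y t) \<le> 0)}"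

lemma sets_list_error [measurable]: "list_error ds C d \<in> sets M"
proof -
  have "{y \<in> space M. sign_errors UNIV y \<le> ds \<and> (\<exists>c\<in>C. hamming_weight c = d \<and> (\<Sum>t\<in>supp c. y t) \<le> 0)} \<in> sets M"
    by measurable
  then show ?thesis by (simp add: list_error_def)
qed

lemma sets_sum_nonpos [measurable]: "{y. (\<Sum>t\<in>S. y t) \<le> 0} \<in> sets M"
proof -
  have "{y \<in> space M. (\<Sum>t\<in>S. y t) \<le> 0} \<in> sets M" by measurable
  then show ?thesis by simp
qed

lemma sets_sign_errors [measurable]: "{y. sign_errors T y \<le> k} \<in> sets M"
proof -
  have "{y \<in> space M. sign_errors T y \<le> k} \<in> sets M" by measurable
  then show ?thesis by simp
qed

lemma pred_sum_nonpos:
  "S \<subseteq> T \<Longrightarrow> Measurable.pred (\<Pi>\<^sub>M t\<in>T. borel) (\<lambda>y. (\<Sum>t\<in>S. y t :: real) \<le> 0)"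
proof -
  assume "S \<subseteq> T"
  then have "(\<lambda>y. \<Sum>t\<in>S. y t :: real) \<in> borel_measurable (\<Pi>\<^sub>M t\<in>T. borel)"
    by (intro borel_measurable_sum measurable_component_singleton) auto
  then show ?thesis
    unfolding pred_def by (rule borel_measurable_le) simp
qed

text \<open>For each codeword the nonpositive sum lives on its \<open>d\<close> support coordinates
  and the error count on the other \<open>n - d\<close>, so the probability factors; then the union
  bound.\<close>

lemma prob_list_error_le_union:
  assumes "0 < d"
  shows "prob (list_error ds C d) \<le> real (weight_spectrum C d) * Q (sqrt d / \<sigma>) * B (Q (1 / \<sigma>)) (CARD('n) - d) 0 (ds - 1)"
    (is "_ \<le> _ * ?q * ?B")
proof -
  let ?W = "{c \<in> C. hamming_weight c = d}"
  let ?E = "\<lambda>c. {y. (\<Sum>t\<in>supp c. y t) \<le> 0 \<and> sign_errors (- supp c) y \<le> ds - 1}"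
  have E: "?E c \<in> sets M" for c
    using sets.Int[OF sets_sum_nonpos sets_sign_errors] by (simp add: Collect_conj_eq)
  have ne: "supp c \<noteq> {}" if "c \<in> ?W" for c
    using that assms card_gt_0_iff[of "supp c"] by (simp add: hamming_weight_def)
  have pE: "prob (?E c) = ?q * ?B" if c: "c \<in> ?W" for c
  proof -
    have card: "card (supp c) = d" using c by (simp add: hamming_weight_def)
    have "prob (?E c) = prob {y. (\<Sum>t\<in>supp c. y t) \<le> 0} * B (Q (1 / \<sigma>)) (card (- supp c)) 0 (ds - 1)"
    proof (rule prob_conj_sign_errors[where S="supp c" and A="\<lambda>y. (\<Sum>t\<in>supp c. y t) \<le> 0"])
      show "sum (restrict y (supp c)) (supp c) \<le> 0 \<longleftrightarrow> sum y (supp c) \<le> 0" for y :: "'n \<Rightarrow> real"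
        by (simp only: sum_restrict order.refl)
    qed (rule Compl_disjoint pred_sum_nonpos order.refl)+
    then show ?thesis
      using prob_sum_nonpos[OF ne[OF c]] card by (simp only: card_Compl_UNIV card)
  qed
  have "list_error ds C d \<subseteq> (\<Union>c\<in>?W. ?E c)"
  proof
    fix y assume "y \<in> list_error ds C d"
    then obtain c where c: "c \<in> ?W" "sign_errors UNIV y \<le> ds" "(\<Sum>t\<in>supp c. y t) \<le> 0"
      by (auto simp: list_error_def)
    then have "sign_errors (- supp c) y \<le> ds - 1"
      using ne[OF c(1)] by (intro sign_errors_outside_le[of y ds "supp c"]) auto
    with c show "y \<in> (\<Union>c\<in>?W. ?E c)" by blast
  qed
  then have "prob (list_error ds C d) \<le> prob (\<Union>c\<in>?W. ?E c)"
    using E by (intro finite_measure_mono sets.finite_UN) auto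
  also have "\<dots> \<le> (\<Sum>c\<in>?W. prob (?E c))"
    using E by (intro finite_measure_subadditive_finite) auto
  also have "\<dots> = real (weight_spectrum C d) * (?q * ?B)"
    using pE by (simp add: weight_spectrum_def)
  finally show ?thesis by (simp add: mult.assoc)
qed

text \<open>The two pairwise comparisons read at most \<open>2 * d\<close> coordinates, and the
  error inside \<open>supp c\<close> leaves at most \<open>ds - 1\<close> elsewhere. Independence
  and the positive correlation of the comparisons give the two factors.\<close>

lemma prob_pair_error_le:
  assumes c: "hamming_weight c = d" "hamming_weight c1 = d" "c \<noteq> c1"
  shows "prob {y. sign_errors UNIV y \<le> ds \<and> (\<Sum>t\<in>supp c. y t) \<le> 0 \<and> \<not> (\<Sum>t\<in>supp c1. y t) \<le> 0}
    \<le> (Q (sqrt d / \<sigma>) - (Q (sqrt d / \<sigma>))\<^sup>2) * B (Q (1 / \<sigma>)) (CARD('n) - 2 * d) 0 (ds - 1)"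
    (is "prob ?E \<le> _")
proof -
  let ?S = "supp c" and ?S1 = "supp c1" and ?q = "Q (sqrt d / \<sigma>)"
  let ?A = "\<lambda>y :: 'n \<Rightarrow> real. (\<Sum>t\<in>?S. y t) \<le> 0 \<and> \<not> (\<Sum>t\<in>?S1. y t) \<le> 0"
  have card: "card ?S = d" "card ?S1 = d" using c by (simp_all add: hamming_weight_def)
  have neq: "?S \<noteq> ?S1" using c(3) by (simp only: supp_inject) simp
  have ne: "?S \<noteq> {}"
  proof
    assume S: "?S = {}"
    then have "card ?S1 = 0" using card by (simp only: card.empty)
    then have "?S1 = {}" by (simp only: card_eq_0_iff finite) simp
    then show False using S neq by simp
  qed
  have "card (?S \<union> ?S1) \<le> 2 * d"
    using card_Un_le[of ?S ?S1] card by simp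
  then have "CARD('n) - 2 * d \<le> card (- (?S \<union> ?S1))"
    by (simp only: card_Compl_UNIV diff_le_mono2)
  \<comment> \<open>The complement of both supports can be larger than \<open>n - 2 * d\<close> when
    they overlap. A subset of exactly this size gives \<open>B\<close> its stated length, and it is
    empty when \<open>2 * d\<close> exceeds the block length.\<close>
  then obtain T where T: "T \<subseteq> - (?S \<union> ?S1)" "card T = CARD('n) - 2 * d"
    by (meson obtain_subset_with_card_n)
  have disj: "(?S \<union> ?S1) \<inter> T = {}" using T(1) by blast
  have r: "sum (restrict y (?S \<union> ?S1)) ?S = sum y ?S" "sum (restrict y (?S \<union> ?S1)) ?S1 = sum y ?S1" for y
    by (simp_all only: sum_restrict Un_upper1 Un_upper2)
  have A: "Measurable.pred (\<Pi>\<^sub>M t\<in>?S \<union> ?S1. borel) ?A"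
    using pred_sum_nonpos[OF Un_upper1, of ?S ?S1] pred_sum_nonpos[OF Un_upper2, of ?S1 ?S]
    by (intro pred_intros_logic)
  have "?E \<subseteq> {y. ?A y \<and> sign_errors T y \<le> ds - 1}"
    using sign_errors_outside_le[of _ ds ?S T] ne disj by blast
  moreover have "{y. ?A y \<and> sign_errors T y \<le> ds - 1} \<in> sets M"
  proof -
    have "{y \<in> space M. ?A y \<and> sign_errors T y \<le> ds - 1} \<in> sets M" by measurable
    then show ?thesis by simp
  qed
  ultimately have "prob ?E \<le> prob {y. ?A y \<and> sign_errors T y \<le> ds - 1}"
    by (rule finite_measure_mono)
  also have "\<dots> = prob {y. ?A y} * B (Q (1 / \<sigma>)) (card T) 0 (ds - 1)"
    by (rule prob_conj_sign_errors[where A="?A", OF disj A]) (simp only: r)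
  also have "\<dots> \<le> (?q - ?q\<^sup>2) * B (Q (1 / \<sigma>)) (card T) 0 (ds - 1)"
  proof (rule mult_right_mono)
    have "{y. ?A y} = {y. sum y ?S \<le> 0} - {y. sum y ?S \<le> 0 \<and> sum y ?S1 \<le> 0}" by auto
    also have "prob \<dots> = prob {y. sum y ?S \<le> 0} - prob {y. sum y ?S \<le> 0 \<and> sum y ?S1 \<le> 0}"
      using sets.Int[OF sets_sum_nonpos sets_sum_nonpos, of ?S ?S1]
      by (intro finite_measure_Diff) (auto simp: Collect_conj_eq)
    also have "\<dots> \<le> ?q - ?q\<^sup>2"
      using prob_sum_nonpos[OF ne] prob_sum_nonpos_pair[OF _ neq] card by simp
    finally show "prob {y. ?A y} \<le> ?q - ?q\<^sup>2" .
    have "B (Q (1 / \<sigma>)) (card T) 0 (ds - 1) = prob {y. 0 \<le> sign_errors T y \<and> sign_errors T y \<le> ds - 1}"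
      by (rule prob_sign_errors[symmetric])
    then show "0 \<le> B (Q (1 / \<sigma>)) (card T) 0 (ds - 1)" by simp
  qed
  finally show ?thesis by (simp only: T(2))
qed

text \<open>A set of \<open>m\<close> coordinates realises this binomial sum as the probability of
  an event.\<close>

lemma B_Q_bounds:
  assumes "m \<le> CARD('n)"
  shows "0 \<le> B (Q (1 / \<sigma>)) m l u" "B (Q (1 / \<sigma>)) m l u \<le> 1"
proof -
  obtain T :: "'n set" where "card T = m"
    using obtain_subset_with_card_n[OF assms] by blast
  then have "B (Q (1 / \<sigma>)) m l u = prob {y. l \<le> sign_errors T y \<and> sign_errors T y \<le> u}"
    by (simp add: prob_sign_errors)
  then show "0 \<le> B (Q (1 / \<sigma>)) m l u" "B (Q (1 / \<sigma>)) m l u \<le> 1" by simp_all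
qed

lemma prob_list_error_le_pairs:
  assumes "0 < d"
  shows "prob (list_error ds C d) \<le> (real (weight_spectrum C d) - 1) * (Q (sqrt d / \<sigma>) - 1 / 2 * (Q (sqrt d / \<sigma>))\<^sup>2)
    * B (Q (1 / \<sigma>)) (CARD('n) - 2 * d) 0 (ds - 1) + Q (sqrt d / \<sigma>)"
    (is "_ \<le> (_ - 1) * (?q - _) * ?B + _")
proof (cases "{c \<in> C. hamming_weight c = d} = {}")
  \<comment> \<open>A code without words of weight \<open>d\<close> still has to satisfy the bound,
    as it may occur in an ensemble. The right side is then \<open>q - r * B\<close> with
    \<open>r = q - q\<^sup>2 / 2\<close>, nonnegative because \<open>r \<le> q\<close> and
    \<open>B \<le> 1\<close>.\<close>
  case True
  then have 0: "list_error ds C d = {}" "weight_spectrum C d = 0"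
    by (auto simp: list_error_def weight_spectrum_def)
  have "?q\<^sup>2 \<le> ?q" using Q_nonneg Q_le_1 by (simp add: power2_eq_square mult_left_le)
  then have "(?q - 1 / 2 * ?q\<^sup>2) * ?B \<le> ?q - 1 / 2 * ?q\<^sup>2"
    using Q_nonneg[of "sqrt d / \<sigma>"] B_Q_bounds by (intro mult_left_le) auto
  also have "\<dots> \<le> ?q" by simp
  finally have "(?q - 1 / 2 * ?q\<^sup>2) * ?B \<le> ?q" .
  then show ?thesis unfolding 0 by (simp add: algebra_simps)
next
  case False
  then obtain c1 where c1: "c1 \<in> {c \<in> C. hamming_weight c = d}" by blast
  let ?W = "{c \<in> C. hamming_weight c = d}"
  let ?E = "\<lambda>c. {y. sign_errors UNIV y \<le> ds \<and> (\<Sum>t\<in>supp c. y t) \<le> 0 \<and> \<not> (\<Sum>t\<in>supp c1. y t) \<le> 0}"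
  let ?F = "{y. (\<Sum>t\<in>supp c1. y t) \<le> 0}"
  have E: "?E c \<in> sets M" for c
  proof -
    have "{y \<in> space M. sign_errors UNIV y \<le> ds \<and> (\<Sum>t\<in>supp c. y t) \<le> 0 \<and> \<not> (\<Sum>t\<in>supp c1. y t) \<le> 0} \<in> sets M"
      by measurable
    then show ?thesis by simp
  qed
  have card_c1: "card (supp c1) = d"
    using c1 by (simp add: hamming_weight_def)
  then have c1_ne: "supp c1 \<noteq> {}"
    using assms card_gt_0_iff[of "supp c1"] by simp
  have pE: "prob (?E c) \<le> (?q - 1 / 2 * ?q\<^sup>2) * ?B" if "c \<in> ?W - {c1}" for c
  proof -
    have "prob (?E c) \<le> (?q - ?q\<^sup>2) * ?B"
      using that c1 by (intro prob_pair_error_le) auto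
    \<comment> \<open>The stated form of the bound is reached by weakening
      \<open>q - q\<^sup>2\<close> to \<open>q - q\<^sup>2 / 2\<close>.\<close>
    also have "\<dots> \<le> (?q - 1 / 2 * ?q\<^sup>2) * ?B"
      using B_Q_bounds by (intro mult_right_mono) auto
    finally show ?thesis .
  qed
  \<comment> \<open>The event of \<open>c1\<close> is counted in full once; every other codeword
    contributes only what lies outside it.\<close>
  have "list_error ds C d \<subseteq> (\<Union>c\<in>?W - {c1}. ?E c) \<union> ?F"
    by (auto simp: list_error_def)
  then have "prob (list_error ds C d) \<le> prob ((\<Union>c\<in>?W - {c1}. ?E c) \<union> ?F)"
    using E by (intro finite_measure_mono sets.Un sets.finite_UN) auto
  also have "\<dots> \<le> prob (\<Union>c\<in>?W - {c1}. ?E c) + prob ?F"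
    using E by (intro measure_Un_le sets.finite_UN) auto
  also have "prob (\<Union>c\<in>?W - {c1}. ?E c) \<le> (\<Sum>c\<in>?W - {c1}. prob (?E c))"
    using E by (intro finite_measure_subadditive_finite) auto
  also have "\<dots> \<le> (\<Sum>c\<in>?W - {c1}. (?q - 1 / 2 * ?q\<^sup>2) * ?B)"
    by (rule sum_mono) (rule pE)
  also have "\<dots> = (real (weight_spectrum C d) - 1) * (?q - 1 / 2 * ?q\<^sup>2) * ?B"
  proof -
    have "card (?W - {c1}) = weight_spectrum C d - 1" "1 \<le> weight_spectrum C d"
      using c1 by (auto simp: weight_spectrum_def Suc_le_eq card_gt_0_iff)
    then show ?thesis by (simp add: of_nat_diff)
  qed
  also have "prob ?F = ?q"
    using prob_sum_nonpos[OF c1_ne] card_c1 by simp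
  finally show ?thesis by simp
qed

text \<open>If 0 is on the list but does not win, some other listed \<open>c\<close> is at least as
  likely. Both lie within \<open>ds\<close> of the hard decision, which caps the weight of
  \<open>c\<close> at \<open>2 * ds\<close>.\<close>

lemma compl_list_region_subset:
  "UNIV - list_region ds C 0 \<subseteq> {y. ds + 1 \<le> sign_errors UNIV y}
    \<union> (\<Union>d\<in>{d. 1 \<le> d \<and> d \<le> CARD('n) \<and> d \<le> 2 * ds}. list_error ds C d)"
proof
  fix y assume y: "y \<in> UNIV - list_region ds C 0"
  have s0: "sign_distance 0 y = sign_errors UNIV y"
    by (simp add: sign_distance_def sign_errors_def bpsk_nth)
  show "y \<in> {y. ds + 1 \<le> sign_errors UNIV y}
    \<union> (\<Union>d\<in>{d. 1 \<le> d \<and> d \<le> CARD('n) \<and> d \<le> 2 * ds}. list_error ds C d)"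
  proof (cases "sign_errors UNIV y \<le> ds")
    case True
    then obtain c where c: "c \<in> C" "c \<noteq> 0" "sign_distance c y \<le> ds" "correlation 0 y \<le> correlation c y"
      using y s0 by (auto simp: list_region_def not_less)
    have "(\<Sum>t\<in>supp c. y t) \<le> 0"
      using correlation_zero_minus[of y c] c(4) by simp
    then have "y \<in> list_error ds C (hamming_weight c)"
      using True c(1) by (auto simp: list_error_def)
    moreover have "hamming_weight c \<le> 2 * ds"
      using hamming_weight_le_sign_distances[of c y] s0 True c(3) by simp
    moreover have "1 \<le> hamming_weight c"
      using c(2) supp_eq_empty_iff[of c] card_gt_0_iff[of "supp c"]
      by (simp only: hamming_weight_def Suc_le_eq One_nat_def) simp
    moreover have "hamming_weight c \<le> CARD('n)"
      unfolding hamming_weight_def by (rule card_mono) auto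
    ultimately show ?thesis by blast
  qed simp
qed

lemma prob_compl_list_region_le:
  "1 - prob (list_region ds C 0) \<le> (\<Sum>d | 1 \<le> d \<and> d \<le> CARD('n) \<and> d \<le> 2 * ds. prob (list_error ds C d))
    + B (Q (1 / \<sigma>)) CARD('n) (ds + 1) CARD('n)"
proof -
  let ?D = "{d. 1 \<le> d \<and> d \<le> CARD('n) \<and> d \<le> 2 * ds}"
  let ?W = "{y. ds + 1 \<le> sign_errors UNIV y}"
  have W: "?W \<in> sets M"
  proof -
    have "{y \<in> space M. ds + 1 \<le> sign_errors UNIV y} \<in> sets M" by measurable
    then show ?thesis by simp
  qed
  have fin: "finite ?D" by (rule finite_subset[of _ "{..CARD('n)}"]) auto
  have "1 - prob (list_region ds C 0) = prob (UNIV - list_region ds C 0)"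
    using prob_compl[OF sets_list_region, of ds C 0] by simp
  also have "\<dots> \<le> prob (?W \<union> (\<Union>d\<in>?D. list_error ds C d))"
    using W fin by (intro finite_measure_mono compl_list_region_subset sets.Un sets.finite_UN) auto
  also have "\<dots> \<le> prob ?W + prob (\<Union>d\<in>?D. list_error ds C d)"
    using W fin by (intro measure_Un_le sets.finite_UN) auto
  also have "prob (\<Union>d\<in>?D. list_error ds C d) \<le> (\<Sum>d\<in>?D. prob (list_error ds C d))"
    using fin by (intro finite_measure_subadditive_finite) auto
  also have "?W = {y. ds + 1 \<le> sign_errors UNIV y \<and> sign_errors UNIV y \<le> CARD('n)}"
    by (auto simp: sign_errors_def intro: card_mono)
  also have "prob \<dots> = B (Q (1 / \<sigma>)) CARD('n) (ds + 1) CARD('n)"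
    by (rule prob_sign_errors)
  finally show ?thesis by simp
qed

end

section \<open>Word and ensemble error probability\<close>

lemma measurable_vec_lambda:
  "(\<lambda>y. (\<chi> t. y t) :: real ^ 'n) \<in> borel_measurable (\<Pi>\<^sub>M t\<in>(UNIV :: 'n::finite set). borel)"
  by (subst borel_measurable_euclidean_space) (auto simp: Basis_vec_def inner_axis)

lemma distr_normal_density_shift:
  assumes "0 < \<sigma>"
  shows "distr (density lborel (normal_density 0 \<sigma>)) (density lborel (normal_density 1 \<sigma>)) (\<lambda>x. 1 + x)
    = density lborel (normal_density 1 \<sigma>)"
proof -
  let ?N = "density lborel (normal_density 0 \<sigma>)"
  interpret prob_space ?N using assms by (rule prob_space_normal_density)
  have "distributed ?N lborel (\<lambda>x. x) (normal_density 0 \<sigma>)"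
    by (auto simp: distributed_def intro!: distr_id2)
  then have "distributed ?N lborel (\<lambda>x. 1 + 1 * x) (normal_density (1 + 1 * 0) (\<bar>1\<bar> * \<sigma>))"
    using assms by (intro normal_density_affine) auto
  then have "distr ?N lborel (\<lambda>x. 1 + x) = density lborel (normal_density 1 \<sigma>)"
    using distributed_distr_eq_density by fastforce
  then show ?thesis by (simp cong: distr_cong)
qed

text \<open>Adding \<open>bpsk 0\<close> shifts each noise coordinate by 1, so the error event can
  be measured under the law of the received vector.\<close>

lemma word_error_prob_eq:
  fixes \<delta> :: "real ^ 'n::finite \<Rightarrow> 'n word"
  assumes \<sigma>: "0 < \<sigma>" and \<delta>: "\<delta> \<in> measurable borel (count_space UNIV)"
  shows "word_error_prob \<sigma> \<delta>
    = measure (\<Pi>\<^sub>M t\<in>UNIV. density lborel (normal_density 1 \<sigma>)) {y. \<delta> (\<chi> t. y t) \<noteq> 0}"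
proof -
  let ?N = "\<lambda>m. density lborel (normal_density m \<sigma>)"
  let ?P = "\<lambda>m. \<Pi>\<^sub>M t\<in>(UNIV :: 'n set). ?N m"
  have sets_P: "sets (?P m) = sets (\<Pi>\<^sub>M t\<in>UNIV. borel)" for m
    by (rule sets_PiM_cong) auto
  have sN: "sigma_finite_measure (?N m)" for m
    using \<sigma> by (intro prob_space_imp_sigma_finite prob_space_normal_density)
  have vec: "(\<lambda>y. \<chi> t. y t) \<in> borel_measurable (?P m)" for m
    using measurable_vec_lambda by (simp add: measurable_cong_sets[OF sets_P refl])
  have shift: "(\<lambda>y. \<lambda>t\<in>UNIV. 1 + y t) \<in> measurable (?P 0) (?P 1)"
    by (intro measurable_restrict) measurable
  have distr: "distr (?P 0) (?P 1) (\<lambda>y. \<lambda>t\<in>UNIV. 1 + y t) = ?P 1"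
    using distr_normal_density_shift[OF \<sigma>] sN by (intro distr_PiM_coordinatewise) auto
  have E: "{z. \<delta> (bpsk 0 + z) \<noteq> 0} \<in> sets borel"
  proof -
    have "(\<lambda>z. \<delta> (bpsk 0 + z)) \<in> measurable borel (count_space UNIV)"
      by (rule measurable_compose[OF _ \<delta>]) simp
    from measurable_sets[OF this, of "- {0}"] show ?thesis
      by (simp add: vimage_def)
  qed
  have F: "{y. \<delta> (\<chi> t. y t) \<noteq> 0} \<in> sets (?P 1)"
    using measurable_sets[OF measurable_compose[OF vec \<delta>], of "- {0}" 1]
    by (simp add: vimage_def space_PiM)
  have "word_error_prob \<sigma> \<delta> = measure (?P 0) {y. \<delta> (bpsk 0 + (\<chi> t. y t)) \<noteq> 0}"
    unfolding word_error_prob_def awgn_def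
    by (subst measure_distr[OF vec E]) (simp add: vimage_def space_PiM)
  also have "\<dots> = measure (?P 0) {y. \<delta> (\<chi> t. 1 + y t) \<noteq> 0}"
  proof -
    have "bpsk 0 + (\<chi> t. y t) = (\<chi> t. 1 + y t)" for y :: "'n \<Rightarrow> real"
      by (simp add: vec_eq_iff bpsk_nth)
    then show ?thesis by simp
  qed
  also have "\<dots> = measure (distr (?P 0) (?P 1) (\<lambda>y. \<lambda>t\<in>UNIV. 1 + y t)) {y. \<delta> (\<chi> t. y t) \<noteq> 0}"
    by (subst measure_distr[OF shift F]) (simp add: vimage_def space_PiM restrict_def)
  finally show ?thesis by (simp only: distr)
qed

context received_vector
begin

lemma word_error_prob_le:
  assumes C: "linear_code C" and \<delta>: "ml_decoder C \<delta>"
  shows "word_error_prob \<sigma> \<delta>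
    \<le> (\<Sum>d | 1 \<le> d \<and> d \<le> CARD('n) \<and> d \<le> 2 * ds. prob (list_error ds C d))
      + B (Q (1 / \<sigma>)) CARD('n) (ds + 1) CARD('n)"
proof -
  let ?T = "\<Union>c\<in>C - {0}. {y. (\<Sum>t\<in>supp c. y t) = 0}"
  have T0: "{y. (\<Sum>t\<in>S. y t) = 0} \<in> sets M" for S
  proof -
    have "{y \<in> space M. (\<Sum>t\<in>S. y t) = 0} \<in> sets M" by measurable
    then show ?thesis by simp
  qed
  have "{y. \<delta> (\<chi> t. y t) \<noteq> 0} \<subseteq> (UNIV - ml_region C 0) \<union> ?T"
  proof
    fix y assume "y \<in> {y. \<delta> (\<chi> t. y t) \<noteq> 0}"
    then have nz: "\<delta> (\<chi> t. y t) \<noteq> 0" by simp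
    let ?c = "\<delta> (\<chi> t. y t)"
    have "is_arg_min (\<lambda>c. dist (\<chi> t. y t) (bpsk c)) (\<lambda>c. c \<in> C) ?c"
      using \<delta> by (simp add: ml_decoder_def)
    then have c: "?c \<in> C" "dist (\<chi> t. y t) (bpsk ?c) \<le> dist (\<chi> t. y t) (bpsk 0)"
      using linear_code_zero[OF C] by (auto simp: is_arg_min_linorder)
    show "y \<in> (UNIV - ml_region C 0) \<union> ?T"
    \<comment> \<open>When 0 is itself a maximiser, a nonzero output means a tie, so the sum over
      its support vanishes. These ties form the null set \<open>?T\<close>.\<close>
    proof (cases "y \<in> ml_region C 0")
      case True
      then have "correlation ?c y = correlation 0 y"
        using c by (intro antisym) (auto simp: ml_region_def dist_bpsk_le_iff)
      then have "(\<Sum>t\<in>supp ?c. y t) = 0"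
        using correlation_zero_minus[of y ?c] by simp
      then show ?thesis using c(1) nz by blast
    qed simp
  qed
  then have "prob {y. \<delta> (\<chi> t. y t) \<noteq> 0} \<le> prob ((UNIV - ml_region C 0) \<union> ?T)"
    using sets.compl_sets[OF sets_ml_region] T0
    by (intro finite_measure_mono sets.Un sets.finite_UN) auto
  also have "\<dots> \<le> prob (UNIV - ml_region C 0) + prob ?T"
    using sets.compl_sets[OF sets_ml_region] T0
    by (intro measure_Un_le sets.finite_UN) auto
  also have "prob ?T \<le> (\<Sum>c\<in>C - {0}. prob {y. (\<Sum>t\<in>supp c. y t) = 0})"
    using T0 by (intro finite_measure_subadditive_finite) auto
  also have "\<dots> = 0"
  proof (rule sum.neutral, rule ballI)
    fix c assume "c \<in> C - {0}"
    then have "supp c \<noteq> {}" using supp_eq_empty_iff[of c] by blast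
    then show "prob {y. (\<Sum>t\<in>supp c. y t) = 0} = 0" by (rule prob_sum_eq_0)
  qed
  also have "prob (UNIV - ml_region C 0) = 1 - prob (ml_region C 0)"
    using prob_compl[OF sets_ml_region, of C 0] by simp
  also have "1 - prob (ml_region C 0) \<le> 1 - prob (list_region ds C 0)"
    using prob_list_region_le_prob_ml_region[OF C] by simp
  also have "\<dots> \<le> (\<Sum>d | 1 \<le> d \<and> d \<le> CARD('n) \<and> d \<le> 2 * ds. prob (list_error ds C d))
      + B (Q (1 / \<sigma>)) CARD('n) (ds + 1) CARD('n)"
    by (rule prob_compl_list_region_le)
  finally have "prob {y. \<delta> (\<chi> t. y t) \<noteq> 0}
    \<le> (\<Sum>d | 1 \<le> d \<and> d \<le> CARD('n) \<and> d \<le> 2 * ds. prob (list_error ds C d))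
      + B (Q (1 / \<sigma>)) CARD('n) (ds + 1) CARD('n)"
    by simp
  moreover have "word_error_prob \<sigma> \<delta> = prob {y. \<delta> (\<chi> t. y t) \<noteq> 0}"
    using \<delta> \<sigma>_pos by (simp add: ml_decoder_def word_error_prob_eq M_eq)
  ultimately show ?thesis by simp
qed

section \<open>Averaging over the ensemble\<close>

lemma finite_set_pmf_code: "finite (set_pmf (p :: 'n code pmf))"
  by (rule finite_subset[OF _ iffD2[OF finite_Pow_iff finite_words[of UNIV]]]) simp

text \<open>Both bounds are affine in the weight spectrum, so they survive averaging over the ensemble.\<close>

lemma expectation_list_error_le_h:
  fixes p :: "'n code pmf"
  assumes "0 < d"
  shows "measure_pmf.expectation p (\<lambda>C. prob (list_error ds C d))
    \<le> h \<sigma> CARD('n) ds d (avg_weight_spectrum p d)"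
proof -
  have int: "integrable (measure_pmf p) f" for f :: "'n code \<Rightarrow> real"
    by (rule integrable_measure_pmf_finite[OF finite_set_pmf_code])
  have affine: "measure_pmf.expectation p (\<lambda>C. prob (list_error ds C d)) \<le> a * avg_weight_spectrum p d + b"
    if "\<And>C. prob (list_error ds C d) \<le> a * real (weight_spectrum C d) + b" for a b
  proof -
    have "measure_pmf.expectation p (\<lambda>C. prob (list_error ds C d))
        \<le> measure_pmf.expectation p (\<lambda>C. a * real (weight_spectrum C d) + b)"
      by (intro integral_mono int that)
    then show ?thesis
      by (simp add: int avg_weight_spectrum_def)
  qed
  let ?q = "Q (sqrt (real d) / \<sigma>)"
  let ?B = "\<lambda>m. B (Q (1 / \<sigma>)) m 0 (ds - 1)"
  \<comment> \<open>Rewrites the second bound in \<open>h\<close> as slope times spectrum plus a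
    constant, the shape that \<open>affine\<close> averages.\<close>
  have regroup: "(a - 1) * r * b + q = r * b * a + (q - r * b)" for a r b q :: real
    by (simp add: algebra_simps)
  have "measure_pmf.expectation p (\<lambda>C. prob (list_error ds C d))
      \<le> ?q * ?B (CARD('n) - d) * avg_weight_spectrum p d + 0"
    using prob_list_error_le_union[OF assms] by (intro affine) (simp add: mult_ac)
  moreover have "measure_pmf.expectation p (\<lambda>C. prob (list_error ds C d))
      \<le> (?q - 1 / 2 * ?q\<^sup>2) * ?B (CARD('n) - 2 * d) * avg_weight_spectrum p d
        + (?q - (?q - 1 / 2 * ?q\<^sup>2) * ?B (CARD('n) - 2 * d))"
    using prob_list_error_le_pairs[OF assms] by (intro affine) (simp only: regroup)
  ultimately show ?thesis
    unfolding h_def Let_def regroup by (simp add: mult_ac)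
qed

lemma ensemble_error_prob_le:
  fixes p :: "'n code pmf"
  assumes "\<And>C. C \<in> set_pmf p \<Longrightarrow> linear_code C" and "\<And>C. C \<in> set_pmf p \<Longrightarrow> ml_decoder C (\<delta> C)"
  shows "ensemble_error_prob \<sigma> p \<delta>
    \<le> (\<Sum>d | 1 \<le> d \<and> d \<le> CARD('n) \<and> d \<le> 2 * ds. h \<sigma> CARD('n) ds d (avg_weight_spectrum p d))
      + B (Q (1 / \<sigma>)) CARD('n) (ds + 1) CARD('n)"
proof -
  let ?D = "{d. 1 \<le> d \<and> d \<le> CARD('n) \<and> d \<le> 2 * ds}"
  have int: "integrable (measure_pmf p) f" for f :: "'n code \<Rightarrow> real"
    by (rule integrable_measure_pmf_finite[OF finite_set_pmf_code])
  \<comment> \<open>Linearity and the decoder property hold only on the support of \<open>p\<close>,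
    so this comparison is almost sure; the later bounds on \<open>list_error\<close> hold for every
    set of words.\<close>
  have "ensemble_error_prob \<sigma> p \<delta> \<le> measure_pmf.expectation p
      (\<lambda>C. (\<Sum>d\<in>?D. prob (list_error ds C d)) + B (Q (1 / \<sigma>)) CARD('n) (ds + 1) CARD('n))"
    unfolding ensemble_error_prob_def using assms
    by (intro integral_mono_AE int AE_pmfI word_error_prob_le)
  also have "\<dots> = (\<Sum>d\<in>?D. measure_pmf.expectation p (\<lambda>C. prob (list_error ds C d)))
      + B (Q (1 / \<sigma>)) CARD('n) (ds + 1) CARD('n)"
    by (simp add: int Bochner_Integration.integral_sum)
  also have "(\<Sum>d\<in>?D. measure_pmf.expectation p (\<lambda>C. prob (list_error ds C d)))
      \<le> (\<Sum>d\<in>?D. h \<sigma> CARD('n) ds d (avg_weight_spectrum p d))"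
    by (intro sum_mono expectation_list_error_le_h) auto
  finally show ?thesis by simp
qed

end

theorem theorem5:
  fixes p :: "'n::finite code pmf"
    and \<delta> :: "'n code \<Rightarrow> real ^ 'n \<Rightarrow> 'n word"
    and \<sigma> :: real and n :: nat
  assumes "n = CARD('n)"
    and "\<sigma> > 0"
    and "\<And>C. C \<in> set_pmf p \<Longrightarrow> linear_code C"
    and "\<And>C. C \<in> set_pmf p \<Longrightarrow> ml_decoder C (\<delta> C)"
  shows "ensemble_error_prob \<sigma> p \<delta> \<le>
    (MIN ds\<in>{0..n}.
       (\<Sum>d | 1 \<le> d \<and> d \<le> n \<and> d \<le> 2 * ds. h \<sigma> n ds d (avg_weight_spectrum p d))
       + B (Q (1 / \<sigma>)) n (ds + 1) n)"
proof -
  interpret received_vector \<sigma> "\<Pi>\<^sub>M t\<in>(UNIV :: 'n set). density lborel (normal_density 1 \<sigma>)"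
    using assms(2) by unfold_locales simp_all
  show ?thesis
    \<comment> \<open>The bound holds for each \<open>ds\<close> separately, hence for the minimum
      over a finite nonempty range.\<close>
    unfolding assms(1) using ensemble_error_prob_le[OF assms(3,4)]
    by (intro Min.boundedI) auto
qed

end
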